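(* Let $\mathbb{I}=\{\mathbb{I}_1,\dots,\mathbb{I}_N\}$ be a random iterated function system on $X=[0,1]^d$ such that every map in every $\mathbb{I}_i$ is a contracting similarity. Assume that $\mathbb{I}$ satisfies the uniform open set condition. Then $$\dim_{\mathrm A}F_\omega\ =\ \max_{i\in\Lambda}\,\dim_{\mathrm A}F_{\underline i}$$ for $\mu$-almost all $\omega\in\Omega$.
   Context: Assouad dimension: for a non-empty bounded set $F\subseteq\mathbb{R}^d$ let $N_r(F)$ be the smallest number of sets of diameter at most $r$ needed to cover $F$. Then $\dim_{\mathrm A}F$ is the infimum of all $\alpha \geq 0$ for which there exist $C,\rho>0$ such that for all $0<r<R\leq\rho$, $\sup_{x\in F}N_r(B(x,R)\cap F)\leq C(R/r)^\alpha$. Random iterated function system (RIFS): $X=[0,1]^d$ with the Euclidean metric, $d\in\mathbb{N}$; $\mathbb{I}=\{\mathbb{I}_1,\dots,\mathbb{I}_N\}$, where each $\mathbb{I}_i=\{S_{i,j}\}_{j\in\mathcal{I}_i}$ is a finite non-empty family of contractions $S_{i,j}:X\to X$. Each $S_{i,j}$ is a similarity: $|S_{i,j}(x)-S_{i,j}(y)|=c_{i,j}|x-y|$ for all $x,y\in X$, with constant $0<c_{i,j}<1$. Let $\Lambda=\{1,\dots,N\}$ and $\Omega=\Lambda^{\mathbb{N}}$ (product topology). For $\omega=(\omega_1,\omega_2,\dots)\in\Omega$, $$F_\omega=\bigcap_{k\geq1}\ \bigcup_{i_1\in\mathcal{I}_{\omega_1},\dots,i_k\in\mathcal{I}_{\omega_k}}S_{\omega_1,i_1}\circ\cdots\circ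 S_{\omega_k,i_k}(X).$$ For $i\in\Lambda$, $\underline i=(i,i,i,\dots)\in\Omega$, so $F_{\underline i}$ is the attractor of the single IFS $\mathbb{I}_i$. Uniform open set condition (UOSC): there is a non-empty open set $U\subseteq X$ such that for each $i\in\Lambda$, $\bigcup_{j\in\mathcal{I}_i}S_{i,j}(U)\subseteq U$ with the union disjoint. Measure: $(p_1,\dots,p_N)$ is a fixed probability vector with all $p_i>0$, and $\mu$ is the Bernoulli (product) Borel probability measure on $\Omega$ giving the cylinder $\{\omega:\omega_1=w_1,\dots,\omega_k=w_k\}$ mass $p_{w_1}p_{w_2}\cdots p_{w_k}$. *)

theory Defs
  imports "HOL-Probability.Probability"
begin

section \<open>Assouad dimension\<close>

text \<open>
  The library's \<^const>\<open>diameter\<close> is a supremum in the reals and carries no information for unbounded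
  sets, so boundedness of the covering sets is demanded explicitly. For bounded \<open>F\<close> and \<open>r > 0\<close>
  a finite cover exists, so the minimum is attained.
\<close>

definition covering_number :: "real \<Rightarrow> 'a::euclidean_space set \<Rightarrow> nat" where
  "covering_number r F =
     (LEAST n. \<exists>\<U>. finite \<U> \<and> card \<U> = n \<and> F \<subseteq> \<Union>\<U> \<and> (\<forall>U\<in>\<U>. bounded U \<and> diameter U \<le> r))"

text \<open>
  Intended for non-empty bounded \<open>F\<close>. The set of admissible exponents then contains the dimension of
  the ambient space, so the infimum is over a non-empty set of non-negative reals.
\<close>

definition assouad_dim :: "'a::euclidean_space set \<Rightarrow> real" where
  "assouad_dim F =
     Inf {\<alpha>. \<alpha> \<ge> 0 \<and>
        (\<exists>C>0. \<exists>\<rho>>0. \<forall>r R. 0 < r \<and> r < R \<and> R \<le> \<rho> \<longrightarrow>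
           (\<forall>x\<in>F. real (covering_number r (cball x R \<inter> F)) \<le> C * (R / r) powr \<alpha>))}"

section \<open>Random iterated function systems of similarities\<close>

definition unit_cube :: "(real ^ 'n::finite) set" where
  "unit_cube = cbox 0 1"

lemma unit_cube_eq: "unit_cube = {x :: real ^ 'n::finite. \<forall>i. 0 \<le> x $ i \<and> x $ i \<le> 1}"
  by (auto simp: unit_cube_def mem_box_cart)

definition contracting_similarity :: "(real ^ 'n::finite \<Rightarrow> real ^ 'n) \<Rightarrow> bool" where
  "contracting_similarity f \<longleftrightarrow>
     f ` unit_cube \<subseteq> unit_cube \<and>
     (\<exists>c. 0 < c \<and> c < 1 \<and> (\<forall>x\<in>unit_cube. \<forall>y\<in>unit_cube. dist (f x) (f y) = c * dist x y))"

text \<open>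
  The system consists of the families \<open>(S i j)\<close>, \<open>j \<in> J i\<close>, for \<open>i \<in> {1..N}\<close>. The maps are total
  functions on \<open>\<real>\<^sup>d\<close>, of which only the restrictions to \<^const>\<open>unit_cube\<close> matter.
\<close>

definition similarity_RIFS ::
    "nat \<Rightarrow> (nat \<Rightarrow> 'j set) \<Rightarrow> (nat \<Rightarrow> 'j \<Rightarrow> real ^ 'n::finite \<Rightarrow> real ^ 'n) \<Rightarrow> bool" where
  "similarity_RIFS N J S \<longleftrightarrow>
     N \<ge> 1 \<and>
     (\<forall>i\<in>{1..N}. finite (J i) \<and> J i \<noteq> {} \<and> (\<forall>j\<in>J i. contracting_similarity (S i j)))"

text \<open>Here "open" means open in the metric space \<^const>\<open>unit_cube\<close>.\<close>

definition UOSC ::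
    "nat \<Rightarrow> (nat \<Rightarrow> 'j set) \<Rightarrow> (nat \<Rightarrow> 'j \<Rightarrow> real ^ 'n::finite \<Rightarrow> real ^ 'n) \<Rightarrow> bool" where
  "UOSC N J S \<longleftrightarrow>
     (\<exists>U. U \<noteq> {} \<and> openin (top_of_set unit_cube) U \<and>
        (\<forall>i\<in>{1..N}. (\<Union>j\<in>J i. S i j ` U) \<subseteq> U \<and> disjoint_family_on (\<lambda>j. S i j ` U) (J i)))"

text \<open>
  Sequences are indexed from 0, so that \<open>\<omega> l\<close> and \<open>w l\<close> stand for \<open>\<omega>\<^sub>l\<^sub>+\<^sub>1\<close> and \<open>i\<^sub>l\<^sub>+\<^sub>1\<close>;
  \<open>word_map S \<omega> w k\<close> is the composition of the \<open>S (\<omega> l) (w l)\<close> for \<open>l = 0, \<dots>, k - 1\<close>, outermost first.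
\<close>

primrec word_map :: "(nat \<Rightarrow> 'j \<Rightarrow> 'a \<Rightarrow> 'a) \<Rightarrow> (nat \<Rightarrow> nat) \<Rightarrow> (nat \<Rightarrow> 'j) \<Rightarrow> nat \<Rightarrow> 'a \<Rightarrow> 'a" where
  "word_map S \<omega> w 0 = id"
| "word_map S \<omega> w (Suc k) = word_map S \<omega> w k \<circ> S (\<omega> k) (w k)"

definition random_attractor ::
    "(nat \<Rightarrow> 'j set) \<Rightarrow> (nat \<Rightarrow> 'j \<Rightarrow> real ^ 'n::finite \<Rightarrow> real ^ 'n) \<Rightarrow> (nat \<Rightarrow> nat) \<Rightarrow> (real ^ 'n) set" where
  "random_attractor J S \<omega> =
     (\<Inter>k\<in>{1..}. \<Union>w\<in>PiE {..<k} (\<lambda>l. J (\<omega> l)). word_map S \<omega> w k ` unit_cube)"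

section \<open>The Bernoulli measure\<close>

definition probability_vector :: "nat \<Rightarrow> (nat \<Rightarrow> real) \<Rightarrow> bool" where
  "probability_vector N p \<longleftrightarrow> (\<forall>i\<in>{1..N}. 0 < p i) \<and> (\<Sum>i\<in>{1..N}. p i) = 1"

definition bernoulli_measure :: "nat \<Rightarrow> (nat \<Rightarrow> real) \<Rightarrow> (nat \<Rightarrow> nat) measure" where
  "bernoulli_measure N p = PiM UNIV (\<lambda>_. point_measure {1..N} (\<lambda>i. ennreal (p i)))"

lemma space_bernoulli_measure: "space (bernoulli_measure N p) = (UNIV \<rightarrow> {1..N})"
  by (simp add: bernoulli_measure_def space_PiM space_point_measure PiE_UNIV_domain)

lemma prob_space_letter:
  assumes "probability_vector N p"
  shows "prob_space (point_measure {1..N} (\<lambda>i. ennreal (p i)))"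
proof
  have "(\<Sum>i\<in>{1..N}. ennreal (p i)) = ennreal (\<Sum>i\<in>{1..N}. p i)"
    using assms by (intro sum_ennreal) (auto simp: probability_vector_def intro: less_imp_le)
  then show "emeasure (point_measure {1..N} (\<lambda>i. ennreal (p i)))
      (space (point_measure {1..N} (\<lambda>i. ennreal (p i)))) = 1"
    using assms by (simp add: space_point_measure emeasure_point_measure_finite probability_vector_def)
qed

lemma emeasure_bernoulli_measure_cylinder:
  assumes p: "probability_vector N p" and w: "\<And>l. l < k \<Longrightarrow> w l \<in> {1..N}"
  shows "emeasure (bernoulli_measure N p) {\<omega> \<in> UNIV \<rightarrow> {1..N}. \<forall>l<k. \<omega> l = w l}
    = ennreal (\<Prod>l<k. p (w l))"
proof -
  let ?M = "\<lambda>_::nat. point_measure {1..N} (\<lambda>i. ennreal (p i))"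
  interpret product_prob_space ?M UNIV
    by (rule product_prob_spaceI) (rule prob_space_letter[OF p])
  have eq: "{\<omega> \<in> UNIV \<rightarrow> {1..N}. \<forall>l<k. \<omega> l = w l} = prod_emb UNIV ?M {..<k} (PiE {..<k} (\<lambda>l. {w l}))"
    by (auto simp: prod_emb_def space_point_measure PiE_UNIV_domain PiE_iff Pi_iff)
  have "emeasure (bernoulli_measure N p) {\<omega> \<in> UNIV \<rightarrow> {1..N}. \<forall>l<k. \<omega> l = w l}
      = (\<Prod>l<k. emeasure (?M l) {w l})"
    unfolding eq bernoulli_measure_def using w
    by (subst emeasure_PiM_emb) (auto simp: sets_point_measure)
  also have "\<dots> = (\<Prod>l<k. ennreal (p (w l)))"
    using w by (intro prod.cong refl) (simp add: emeasure_point_measure_finite)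
  also have "\<dots> = ennreal (\<Prod>l<k. p (w l))"
    using w p by (intro prod_ennreal) (auto simp: probability_vector_def intro!: less_imp_le)
  finally show ?thesis .
qed

end

theory Submission imports Defs begin

text \<open>
  For each letter \<open>i\<close> let \<open>s i \<ge> 0\<close> be the similarity dimension of the \<open>i\<close>-th family, the solution of
  \<open>(\<Sum>j\<in>J i. c i j powr s i) = 1\<close> (\<open>moran_equation_solvable\<close>). The theorem holds because a
  dimension that records the worst location and scale sees only the worst stretches of the random
  sequence, and almost surely arbitrarily long runs of every single letter occur.

  The quantitative tool is the cut set of a level \<open>r\<close>: the finite words whose composed map has
  contraction ratio about \<open>r\<close>. A recursion over the first letter (\<open>cut_set_exists\<close>) shows that there are at
  most \<open>(a * r) powr - s\<close> such words if no letter has similarity dimension above \<open>s\<close>, where \<open>a\<close> is a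
  lower bound for the ratios, and at least \<open>r powr - s\<close> if all letters read have similarity dimension at least \<open>s\<close>.
  The open set condition makes the corresponding copies of \<open>U\<close> disjoint. Each contains a round ball of
  comparable size, since a similarity of the cube is the restriction of an affine similarity
  (\<open>cube_sim_extends_affinely\<close>). A volume argument then shows that only boundedly many cylinders of size
  about \<open>r\<close> come within distance \<open>r\<close> of a given point (\<open>card_separated_le\<close>).

  These facts give the upper bound \<open>max s\<close> for every sequence (\<open>covering_number_attractor_le\<close>): cover by
  cylinders of size \<open>R\<close> and refine those that meet the ball to size \<open>r\<close>. They also give the lower bound
  \<open>s i\<close> for every sequence that contains arbitrarily long runs of \<open>i\<close> (\<open>exponent_ge_of_runs\<close>). Applied to
  the constant sequence, both bounds show that its attractor has dimension \<open>s i\<close>. Applied to a random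
  sequence, which has such runs almost surely (\<open>AE_bernoulli_run\<close>), they give the maximum of the \<open>s i\<close>.
\<close>

section \<open>Similarities of the unit cube\<close>

text \<open>
  The ratio is an explicit argument and may equal 1, so that the empty composition qualifies and
  ratios multiply along compositions.
\<close>

definition cube_sim :: "(real ^ 'n::finite \<Rightarrow> real ^ 'n) \<Rightarrow> real \<Rightarrow> bool" where
  "cube_sim f c \<longleftrightarrow> f ` unit_cube \<subseteq> unit_cube \<and> 0 < c \<and>
     (\<forall>x\<in>unit_cube. \<forall>y\<in>unit_cube. dist (f x) (f y) = c * dist x y)"

lemma cube_sim_pos: "cube_sim f c \<Longrightarrow> 0 < c"
  and cube_sim_maps: "cube_sim f c \<Longrightarrow> x \<in> unit_cube \<Longrightarrow> f x \<in> unit_cube"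
  and cube_sim_dist: "cube_sim f c \<Longrightarrow> x \<in> unit_cube \<Longrightarrow> y \<in> unit_cube \<Longrightarrow> dist (f x) (f y) = c * dist x y"
  by (auto simp: cube_sim_def)

lemma cube_sim_id: "cube_sim id 1"
  by (simp add: cube_sim_def)

lemma cube_sim_compose:
  assumes "cube_sim f c" "cube_sim g d"
  shows "cube_sim (f \<circ> g) (c * d)"
  using assms unfolding cube_sim_def by (auto simp: image_subset_iff)

lemma cube_sim_inj_on:
  assumes "cube_sim f c"
  shows "inj_on f unit_cube"
proof (rule inj_onI)
  fix x y assume "x \<in> unit_cube" "y \<in> unit_cube" "f x = f y"
  then show "x = y"
    using cube_sim_dist[OF assms, of x y] cube_sim_pos[OF assms] by simp
qed

lemma cube_sim_continuous_on:
  fixes f :: "real ^ 'n::finite \<Rightarrow> real ^ 'n"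
  assumes "cube_sim f c"
  shows "continuous_on unit_cube f"
  unfolding continuous_on_iff
proof (intro ballI allI impI)
  fix x :: "real ^ 'n" and e :: real assume x: "x \<in> unit_cube" and e: "0 < e"
  show "\<exists>d>0. \<forall>x'\<in>unit_cube. dist x' x < d \<longrightarrow> dist (f x') (f x) < e"
    using cube_sim_dist[OF assms _ x] cube_sim_pos[OF assms] e
    by (intro exI[of _ "e / c"]) (auto simp: field_simps)
qed

lemma zero_in_unit_cube: "0 \<in> unit_cube"
  by (simp add: unit_cube_eq)

lemma axis_in_unit_cube: "axis i 1 \<in> unit_cube"
  by (simp add: unit_cube_eq axis_def)

lemma compact_unit_cube: "compact unit_cube"
  by (simp add: unit_cube_def)

text \<open>
  Normalise the similarity to an isometry \<open>g\<close> of the cube that fixes the corner \<open>0\<close>. By polarisation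
  \<open>g\<close> preserves inner products. The cube contains the standard basis, so its image under \<open>g\<close> is
  again orthonormal, and the linear map \<open>T\<close> that it determines agrees with \<open>g\<close> on the cube. The point
  of the extension is that it is surjective, which says what \<open>f\<close> does to balls.
\<close>

lemma cube_sim_extends_affinely:
  fixes f :: "real ^ 'n::finite \<Rightarrow> real ^ 'n"
  assumes f: "cube_sim f c"
  obtains T where "orthogonal_transformation T"
    and "\<And>x. x \<in> unit_cube \<Longrightarrow> f x = f 0 + c *\<^sub>R T x"
proof -
  define g where "g x = (1 / c) *\<^sub>R (f x - f 0)" for x
  note c = cube_sim_pos[OF f]
  have dg: "norm (g x - g y) = norm (x - y)" if "x \<in> unit_cube" "y \<in> unit_cube" for x y
  proof -
    have "g x - g y = (1 / c) *\<^sub>R (f x - f y)"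
      by (simp add: g_def algebra_simps)
    then show ?thesis
      using cube_sim_dist[OF f that] c by (simp add: dist_norm)
  qed
  have ng: "norm (g x) = norm x" if "x \<in> unit_cube" for x
    using dg[OF that zero_in_unit_cube] by (simp add: g_def)
  have ig: "g x \<bullet> g y = x \<bullet> y" if "x \<in> unit_cube" "y \<in> unit_cube" for x y
    by (simp add: dot_norm_neg dg ng that)
  define T where "T v = (\<Sum>i\<in>UNIV. v $ i *\<^sub>R g (axis i 1))" for v :: "real ^ 'n"
  have lin: "linear T"
    by (rule linearI)
      (simp_all add: T_def scaleR_add_left sum.distrib scaleR_sum_right)
  have gT: "g x \<bullet> T v = x \<bullet> v" if "x \<in> unit_cube" for x v
  proof -
    have "g x \<bullet> T v = (\<Sum>i\<in>UNIV. v $ i * (g x \<bullet> g (axis i 1)))"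
      by (simp add: T_def inner_sum_right)
    also have "\<dots> = (\<Sum>i\<in>UNIV. v $ i * x $ i)"
      by (simp add: ig that axis_in_unit_cube inner_axis)
    finally show ?thesis by (simp add: inner_vec_def mult.commute)
  qed
  have TT: "T v \<bullet> T v = v \<bullet> v" for v
  proof -
    have "T v \<bullet> T v = (\<Sum>i\<in>UNIV. v $ i * (g (axis i 1) \<bullet> T v))"
      by (subst (1) T_def) (simp add: inner_sum_left)
    also have "\<dots> = (\<Sum>i\<in>UNIV. v $ i * v $ i)"
      by (simp add: gT axis_in_unit_cube inner_axis')
    finally show ?thesis by (simp add: inner_vec_def)
  qed
  have "orthogonal_transformation T"
    unfolding orthogonal_transformation using lin TT by (simp add: norm_eq_sqrt_inner)
  moreover have "f x = f 0 + c *\<^sub>R T x" if x: "x \<in> unit_cube" for x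
  proof -
    have "(g x - T x) \<bullet> (g x - T x) = 0"
      by (simp add: inner_diff_left inner_diff_right gT[OF x] ig[OF x x] TT inner_commute[of "T x" "g x"])
    then have "g x = T x" by simp
    then show ?thesis using c by (simp add: g_def flip: \<open>g x = T x\<close>)
  qed
  ultimately show ?thesis by (rule that)
qed

text \<open>
  This is where the maps being exact similarities is essential for the separation of cylinders: the
  image of the open set of the open set condition contains a round ball of comparable size.
\<close>

lemma cube_sim_image_ball:
  fixes f :: "real ^ 'n::finite \<Rightarrow> real ^ 'n"
  assumes f: "cube_sim f c" and b: "ball z e \<subseteq> unit_cube" and e: "0 < e"
  shows "f ` ball z e = ball (f z) (c * e)"
proof -
  obtain T where T: "orthogonal_transformation T"
    and fT: "\<And>x. x \<in> unit_cube \<Longrightarrow> f x = f 0 + c *\<^sub>R T x"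
    using cube_sim_extends_affinely[OF f] by metis
  note c = cube_sim_pos[OF f]
  have z: "z \<in> unit_cube" using b e by auto
  have "f ` ball z e = (\<lambda>x. f 0 + c *\<^sub>R T x) ` ball z e"
    using b fT by (intro image_cong) auto
  also have "\<dots> = (+) (f 0) ` (*\<^sub>R) c ` T ` ball z e"
    by (simp add: image_image)
  also have "\<dots> = ball (c *\<^sub>R T z + f 0) (c * e)"
    using T c by (simp add: image_orthogonal_transformation_ball ball_scale)
  finally show ?thesis using fT[OF z] by (simp add: add.commute)
qed

lemma openin_unit_cube_contains_ball:
  fixes U :: "(real ^ 'n::finite) set"
  assumes "openin (top_of_set unit_cube) U" "U \<noteq> {}"
  obtains z e where "0 < e" "ball z e \<subseteq> U"
proof -
  obtain W where W: "open W" "U = unit_cube \<inter> W"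
    using assms(1) by (auto simp: openin_open)
  have "box 0 (1 :: real ^ 'n) \<noteq> {}"
    unfolding interval_ne_empty_cart by simp
  then have "unit_cube = closure (box 0 (1 :: real ^ 'n))"
    by (simp add: unit_cube_def closure_box)
  then have "box 0 1 \<inter> W \<noteq> {}"
    using assms(2) W open_Int_closure_eq_empty[of W "box 0 1"] by (auto simp: Int_commute)
  moreover have "open (box 0 1 \<inter> W)"
    using W by auto
  ultimately obtain z e where "0 < e" "ball z e \<subseteq> box 0 1 \<inter> W"
    by (meson equals0I open_contains_ball)
  moreover have "box 0 1 \<inter> W \<subseteq> U"
    using W box_subset_cbox by (auto simp: unit_cube_def)
  ultimately show ?thesis using that by blast
qed

text \<open>
  The volume comparison: the balls fit disjointly into the ball of radius \<open>L + r\<close> about \<open>y\<close>.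
\<close>

lemma card_disjoint_balls_le:
  fixes q :: "'i \<Rightarrow> 'a::euclidean_space"
  assumes fin: "finite A" and r: "0 < r" and L: "0 \<le> L"
    and disj: "disjoint_family_on (\<lambda>v. ball (q v) r) A"
    and near: "\<And>v. v \<in> A \<Longrightarrow> dist y (q v) \<le> L"
  shows "real (card A) \<le> ((L + r) / r) ^ DIM('a)"
proof -
  have "real (card A) * (unit_ball_vol (real DIM('a)) * r ^ DIM('a))
      = (\<Sum>v\<in>A. measure lebesgue (ball (q v) r))"
    using r by (simp add: content_ball)
  also have "\<dots> = measure lebesgue (\<Union>v\<in>A. ball (q v) r)"
    using fin disj emeasure_lborel_ball_finite
    by (subst measure_finite_Union[symmetric]) (auto simp: less_top)
  also have "\<dots> \<le> measure lebesgue (ball y (L + r))"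
  proof (rule measure_mono_fmeasurable)
    show "(\<Union>v\<in>A. ball (q v) r) \<subseteq> ball y (L + r)"
    proof
      fix x assume "x \<in> (\<Union>v\<in>A. ball (q v) r)"
      then obtain v where "v \<in> A" "dist (q v) x < r" by auto
      then show "x \<in> ball y (L + r)"
        using near[of v] dist_triangle[of y x "q v"] by simp
    qed
  qed (use fin in auto)
  also have "\<dots> = unit_ball_vol (real DIM('a)) * (L + r) ^ DIM('a)"
    using r L by (simp add: content_ball)
  finally have "real (card A) * r ^ DIM('a) \<le> (L + r) ^ DIM('a)"
    using unit_ball_vol_pos[of "real DIM('a)"] by (simp add: mult.left_commute)
  then show ?thesis
    using r by (simp add: power_divide field_simps)
qed

section \<open>The levels of the construction\<close>

definition shift :: "nat \<Rightarrow> (nat \<Rightarrow> 'a) \<Rightarrow> nat \<Rightarrow> 'a" where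
  "shift k \<omega> l = \<omega> (k + l)"

lemma shift_0 [simp]: "shift 0 \<omega> = \<omega>"
  and shift_shift [simp]: "shift k (shift m \<omega>) = shift (m + k) \<omega>"
  by (auto simp: shift_def fun_eq_iff add.assoc)

lemma shift_in_Pi: "\<omega> \<in> UNIV \<rightarrow> L \<Longrightarrow> shift k \<omega> \<in> UNIV \<rightarrow> L"
  by (auto simp: shift_def)

text \<open>
  The sets whose intersection is the attractor, built from the outermost map inwards. In this form
  the recursion passes to the shifted sequence, which is how all later inductions proceed.
\<close>

primrec level :: "(nat \<Rightarrow> 'j set) \<Rightarrow> (nat \<Rightarrow> 'j \<Rightarrow> real ^ 'n::finite \<Rightarrow> real ^ 'n) \<Rightarrow> nat
    \<Rightarrow> (nat \<Rightarrow> nat) \<Rightarrow> (real ^ 'n) set" where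
  "level J S 0 \<omega> = unit_cube"
| "level J S (Suc k) \<omega> = (\<Union>j\<in>J (\<omega> 0). S (\<omega> 0) j ` level J S k (shift 1 \<omega>))"

lemma word_map_Suc_outermost:
  "word_map S \<omega> w (Suc k) = S (\<omega> 0) (w 0) \<circ> word_map S (shift 1 \<omega>) (shift 1 w) k"
proof (induction k)
  case (Suc k)
  have "word_map S \<omega> w (Suc (Suc k)) = word_map S \<omega> w (Suc k) \<circ> S (\<omega> (Suc k)) (w (Suc k))"
    by (rule word_map.simps)
  then show ?case
    unfolding Suc.IH by (simp add: comp_assoc) (simp add: shift_def)
qed simp

lemma UN_word_map_eq_level:
  "(\<Union>w\<in>PiE {..<k} (\<lambda>l. J (\<omega> l)). word_map S \<omega> w k ` unit_cube) = level J S k \<omega>"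
proof (induction k arbitrary: \<omega>)
  case (Suc k)
  show ?case
  proof (intro equalityI subsetI)
    fix x assume "x \<in> (\<Union>w\<in>PiE {..<Suc k} (\<lambda>l. J (\<omega> l)). word_map S \<omega> w (Suc k) ` unit_cube)"
    then obtain w where w: "w \<in> PiE {..<Suc k} (\<lambda>l. J (\<omega> l))"
      and x: "x \<in> S (\<omega> 0) (w 0) ` word_map S (shift 1 \<omega>) (shift 1 w) k ` unit_cube"
      unfolding word_map_Suc_outermost by (auto simp: image_comp)
    have "shift 1 w \<in> PiE {..<k} (\<lambda>l. J (shift 1 \<omega> l))"
      using w by (auto simp: PiE_iff shift_def extensional_def)
    then have "word_map S (shift 1 \<omega>) (shift 1 w) k ` unit_cube \<subseteq> level J S k (shift 1 \<omega>)"
      unfolding Suc.IH[symmetric] by blast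
    moreover have "w 0 \<in> J (\<omega> 0)" using w by auto
    ultimately show "x \<in> level J S (Suc k) \<omega>" using x by auto
  next
    fix x assume "x \<in> level J S (Suc k) \<omega>"
    then obtain j w where j: "j \<in> J (\<omega> 0)" and w: "w \<in> PiE {..<k} (\<lambda>l. J (shift 1 \<omega> l))"
      and x: "x \<in> S (\<omega> 0) j ` word_map S (shift 1 \<omega>) w k ` unit_cube"
      by (auto simp flip: Suc.IH)
    have "case_nat j w \<in> PiE {..<Suc k} (\<lambda>l. J (\<omega> l))"
      using j w by (auto simp: PiE_iff extensional_def shift_def split: nat.splits)
    moreover have "shift 1 (case_nat j w) = w" by (auto simp: shift_def)
    then have "x \<in> word_map S \<omega> (case_nat j w) (Suc k) ` unit_cube"
      using x unfolding word_map_Suc_outermost by (simp add: image_comp)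
    ultimately show "x \<in> (\<Union>w\<in>PiE {..<Suc k} (\<lambda>l. J (\<omega> l)). word_map S \<omega> w (Suc k) ` unit_cube)"
      by blast
  qed
qed simp

section \<open>Finite words\<close>

text \<open>
  Cut sets contain words of different lengths, hence lists instead of functions on an initial
  segment.
\<close>

primrec word :: "(nat \<Rightarrow> 'j set) \<Rightarrow> 'j list \<Rightarrow> (nat \<Rightarrow> nat) \<Rightarrow> bool" where
  "word J [] \<omega> \<longleftrightarrow> True"
| "word J (j # v) \<omega> \<longleftrightarrow> j \<in> J (\<omega> 0) \<and> word J v (shift 1 \<omega>)"

primrec wmap :: "(nat \<Rightarrow> 'j \<Rightarrow> 'a \<Rightarrow> 'a) \<Rightarrow> 'j list \<Rightarrow> (nat \<Rightarrow> nat) \<Rightarrow> 'a \<Rightarrow> 'a" where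
  "wmap S [] \<omega> = id"
| "wmap S (j # v) \<omega> = S (\<omega> 0) j \<circ> wmap S v (shift 1 \<omega>)"

primrec wratio :: "(nat \<Rightarrow> 'j \<Rightarrow> real) \<Rightarrow> 'j list \<Rightarrow> (nat \<Rightarrow> nat) \<Rightarrow> real" where
  "wratio c [] \<omega> = 1"
| "wratio c (j # v) \<omega> = c (\<omega> 0) j * wratio c v (shift 1 \<omega>)"

lemma divide_powr_minus:
  fixes x y s :: real
  assumes "0 < x" "0 < y"
  shows "(x / y) powr - s = x powr - s * y powr s"
  using assms by (simp add: powr_divide powr_minus field_simps)

text \<open>
  A uniformly separated system with letters from \<open>L\<close>, together with the data on which the
  estimates depend: ratios \<open>c i j\<close> lying in \<open>[a, b]\<close>, the open set \<open>U\<close> and a Euclidean ball inside it.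
\<close>

locale separated_RIFS =
  fixes L :: "nat set" and J :: "nat \<Rightarrow> 'j set"
    and S :: "nat \<Rightarrow> 'j \<Rightarrow> real ^ 'n::finite \<Rightarrow> real ^ 'n"
    and c :: "nat \<Rightarrow> 'j \<Rightarrow> real" and a b :: real
    and U :: "(real ^ 'n) set" and z :: "real ^ 'n" and e :: real
  assumes finite_J: "i \<in> L \<Longrightarrow> finite (J i)"
    and J_nonempty: "i \<in> L \<Longrightarrow> J i \<noteq> {}"
    and sim: "i \<in> L \<Longrightarrow> j \<in> J i \<Longrightarrow> cube_sim (S i j) (c i j)"
    and a_le: "i \<in> L \<Longrightarrow> j \<in> J i \<Longrightarrow> a \<le> c i j"
    and le_b: "i \<in> L \<Longrightarrow> j \<in> J i \<Longrightarrow> c i j \<le> b"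
    and a_pos: "0 < a" and a_less_1: "a < 1" and b_pos: "0 < b" and b_less_1: "b < 1"
    and U_cube: "U \<subseteq> unit_cube" and ball_U: "ball z e \<subseteq> U" and e_pos: "0 < e"
    and S_U: "i \<in> L \<Longrightarrow> j \<in> J i \<Longrightarrow> S i j ` U \<subseteq> U"
    and S_disjoint: "i \<in> L \<Longrightarrow> disjoint_family_on (\<lambda>j. S i j ` U) (J i)"
begin

section \<open>Self-similarity of the attractors\<close>

abbreviation F :: "(nat \<Rightarrow> nat) \<Rightarrow> (real ^ 'n) set" where
  "F \<equiv> random_attractor J S"

lemma level_Suc_subset:
  "\<omega> \<in> UNIV \<rightarrow> L \<Longrightarrow> level J S (Suc k) \<omega> \<subseteq> level J S k \<omega>"
proof (induction k arbitrary: \<omega>)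
  case 0
  then show ?case
    using cube_sim_maps[OF sim] by fastforce
next
  case (Suc k)
  have "level J S (Suc k) (shift 1 \<omega>) \<subseteq> level J S k (shift 1 \<omega>)"
    by (rule Suc.IH) (rule shift_in_Pi[OF Suc.prems])
  then show ?case
    by (subst (2) level.simps, subst level.simps) blast
qed

lemma level_antimono:
  assumes "\<omega> \<in> UNIV \<rightarrow> L" "k \<le> m"
  shows "level J S m \<omega> \<subseteq> level J S k \<omega>"
  using lift_Suc_antimono_le[of "\<lambda>k. level J S k \<omega>", OF level_Suc_subset assms(2)] assms(1) by blast

lemma attractor_eq_Inter_level:
  assumes "\<omega> \<in> UNIV \<rightarrow> L"
  shows "F \<omega> = (\<Inter>k. level J S k \<omega>)"
proof -
  have "level J S 1 \<omega> \<subseteq> level J S 0 \<omega>"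
    by (rule level_antimono[OF assms]) simp
  then have "(\<Inter>k\<in>{1..}. level J S k \<omega>) \<subseteq> level J S k \<omega>" for k
    by (cases "k = 0") (auto simp del: level.simps)
  then show ?thesis
    unfolding random_attractor_def UN_word_map_eq_level by blast
qed

lemma attractor_subset_cube: "\<omega> \<in> UNIV \<rightarrow> L \<Longrightarrow> F \<omega> \<subseteq> unit_cube"
  unfolding attractor_eq_Inter_level by (rule INF_lower2[of 0]) auto

text \<open>
  A point of the attractor lies, for every level, in the image of that level under one of the
  finitely many first maps. Some first map occurs for infinitely many levels, hence for all levels as
  these decrease, and its injectivity turns the preimages into a single point.
\<close>

lemma attractor_self_similar:
  assumes \<omega>: "\<omega> \<in> UNIV \<rightarrow> L"
  shows "F \<omega> = (\<Union>j\<in>J (\<omega> 0). S (\<omega> 0) j ` F (shift 1 \<omega>))"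
proof (intro equalityI subsetI)
  note \<omega>' = shift_in_Pi[OF \<omega>, of 1]
  have \<omega>0: "\<omega> 0 \<in> L" using \<omega> by auto
  {
    fix x assume x: "x \<in> F \<omega>"
    have "\<exists>j\<in>J (\<omega> 0). x \<in> S (\<omega> 0) j ` level J S k (shift 1 \<omega>)" for k
    proof -
      have "x \<in> level J S (Suc k) \<omega>"
        using x unfolding attractor_eq_Inter_level[OF \<omega>] by blast
      then show ?thesis by simp
    qed
    then have "\<forall>k. \<exists>j. j \<in> J (\<omega> 0) \<and> x \<in> S (\<omega> 0) j ` level J S k (shift 1 \<omega>)" by blast
    then obtain f where f: "\<And>k. f k \<in> J (\<omega> 0)"
      "\<And>k. x \<in> S (\<omega> 0) (f k) ` level J S k (shift 1 \<omega>)"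
      by metis
    have "finite (range f)"
      using f(1) finite_J[OF \<omega>0] by (meson finite_subset image_subsetI)
    then obtain k0 where "infinite {k. f k = f k0}"
      using pigeonhole_infinite[of UNIV f] by auto
    then have large: "\<exists>m\<ge>k. f m = f k0" for k
      unfolding infinite_nat_iff_unbounded_le by blast
    define j where "j = f k0"
    have j: "j \<in> J (\<omega> 0)" using f(1) by (simp add: j_def)
    have xj: "x \<in> S (\<omega> 0) j ` level J S k (shift 1 \<omega>)" for k
      using large[of k] f(2) level_antimono[OF \<omega>', of k] unfolding j_def
      by (metis image_mono subsetD)
    obtain y where y: "y \<in> unit_cube" "x = S (\<omega> 0) j y"
      using xj[of 0] by auto
    have "y \<in> level J S k (shift 1 \<omega>)" for k
    proof -
      obtain y' where y': "y' \<in> level J S k (shift 1 \<omega>)" "x = S (\<omega> 0) j y'"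
        using xj[of k] by blast
      moreover have "y' \<in> unit_cube"
        using level_antimono[OF \<omega>', of 0 k] y' by auto
      ultimately show ?thesis
        using inj_onD[OF cube_sim_inj_on[OF sim[OF \<omega>0 j]]] y by metis
    qed
    then have "y \<in> F (shift 1 \<omega>)"
      unfolding attractor_eq_Inter_level[OF \<omega>'] by blast
    then show "x \<in> (\<Union>j\<in>J (\<omega> 0). S (\<omega> 0) j ` F (shift 1 \<omega>))"
      using j y by blast
  }
  {
    fix x assume "x \<in> (\<Union>j\<in>J (\<omega> 0). S (\<omega> 0) j ` F (shift 1 \<omega>))"
    then have "x \<in> level J S (Suc k) \<omega>" for k
      unfolding attractor_eq_Inter_level[OF \<omega>'] by auto
    then show "x \<in> F \<omega>"
      unfolding attractor_eq_Inter_level[OF \<omega>] using level_Suc_subset[OF \<omega>] by blast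
  }
qed

lemma compact_level: "\<omega> \<in> UNIV \<rightarrow> L \<Longrightarrow> compact (level J S k \<omega>)"
proof (induction k arbitrary: \<omega>)
  case (Suc k)
  have \<omega>0: "\<omega> 0 \<in> L" using Suc.prems by auto
  note \<omega>' = shift_in_Pi[OF Suc.prems, of 1]
  have "continuous_on (level J S k (shift 1 \<omega>)) (S (\<omega> 0) j)" if "j \<in> J (\<omega> 0)" for j
    using cube_sim_continuous_on[OF sim[OF \<omega>0 that]] level_antimono[OF \<omega>', of 0 k]
    by (auto intro: continuous_on_subset)
  then show ?case
    using finite_J[OF \<omega>0] Suc.IH[OF \<omega>'] by (auto intro!: compact_UN compact_continuous_image)
qed (simp add: compact_unit_cube)

lemma level_nonempty: "\<omega> \<in> UNIV \<rightarrow> L \<Longrightarrow> level J S k \<omega> \<noteq> {}"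
proof (induction k arbitrary: \<omega>)
  case (Suc k)
  then show ?case
    using J_nonempty[of "\<omega> 0"] Suc.IH[OF shift_in_Pi[OF Suc.prems, of 1]] by auto
qed (use zero_in_unit_cube in auto)

lemma attractor_nonempty:
  assumes "\<omega> \<in> UNIV \<rightarrow> L"
  shows "F \<omega> \<noteq> {}"
  unfolding attractor_eq_Inter_level[OF assms]
  by (rule compact_nest) (use assms compact_level level_nonempty level_antimono in auto)

lemma word_sim:
  "\<omega> \<in> UNIV \<rightarrow> L \<Longrightarrow> word J v \<omega> \<Longrightarrow> cube_sim (wmap S v \<omega>) (wratio c v \<omega>)"
proof (induction v arbitrary: \<omega>)
  case (Cons j v)
  then have "cube_sim (S (\<omega> 0) j) (c (\<omega> 0) j)" by (intro sim) auto
  moreover have "cube_sim (wmap S v (shift 1 \<omega>)) (wratio c v (shift 1 \<omega>))"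
    using Cons.prems by (intro Cons.IH shift_in_Pi) auto
  ultimately show ?case
    unfolding wmap.simps wratio.simps by (rule cube_sim_compose)
qed (simp add: cube_sim_id)

lemma word_U: "\<omega> \<in> UNIV \<rightarrow> L \<Longrightarrow> word J v \<omega> \<Longrightarrow> wmap S v \<omega> ` U \<subseteq> U"
proof (induction v arbitrary: \<omega>)
  case (Cons j v)
  then have "S (\<omega> 0) j ` U \<subseteq> U" by (intro S_U) auto
  moreover have "wmap S v (shift 1 \<omega>) ` U \<subseteq> U"
    using Cons.prems by (intro Cons.IH shift_in_Pi) auto
  ultimately show ?case by auto
qed simp

lemma word_attractor:
  "\<omega> \<in> UNIV \<rightarrow> L \<Longrightarrow> word J v \<omega> \<Longrightarrow> wmap S v \<omega> ` F (shift (length v) \<omega>) \<subseteq> F \<omega>"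
proof (induction v arbitrary: \<omega>)
  case (Cons j v)
  have "wmap S v (shift 1 \<omega>) ` F (shift (length v) (shift 1 \<omega>)) \<subseteq> F (shift 1 \<omega>)"
    using Cons.prems by (intro Cons.IH shift_in_Pi) auto
  then show ?case
    using Cons.prems attractor_self_similar[OF Cons.prems(1)] by (fastforce simp: image_subset_iff)
qed simp

lemma obtain_word:
  assumes "\<omega> \<in> UNIV \<rightarrow> L"
  obtains v where "word J v \<omega>" "length v = k" "wratio c v \<omega> \<le> b ^ k"
proof -
  have "\<exists>v. word J v \<omega> \<and> length v = k \<and> wratio c v \<omega> \<le> b ^ k"
    using assms
  proof (induction k arbitrary: \<omega>)
    case 0
    show ?case by (intro exI[of _ "[]"]) simp
  next
    case (Suc k)
    note \<omega>' = shift_in_Pi[OF Suc.prems, of 1]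
    have \<omega>0: "\<omega> 0 \<in> L" using Suc.prems by auto
    obtain v where v: "word J v (shift 1 \<omega>)" "length v = k" "wratio c v (shift 1 \<omega>) \<le> b ^ k"
      using Suc.IH[OF \<omega>'] by blast
    obtain j where j: "j \<in> J (\<omega> 0)" using J_nonempty[OF \<omega>0] by blast
    have "c (\<omega> 0) j * wratio c v (shift 1 \<omega>) \<le> b * b ^ k"
      using v(3) le_b[OF \<omega>0 j] b_pos cube_sim_pos[OF word_sim[OF \<omega>' v(1)]]
      by (intro mult_mono) auto
    then show ?case using v j by (intro exI[of _ "j # v"]) simp
  qed
  then show ?thesis using that by blast
qed

section \<open>Cut sets\<close>

text \<open>
  The words at which the ratio first drops to size about \<open>r\<close>. The two cardinality clauses replace the
  usual statement about the weighted sums of \<open>wratio c v \<omega> powr s\<close>: for these words all weights are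
  comparable to \<open>r powr s\<close>, so bounds on sums of first-level weights turn into bounds on the number
  of words.
\<close>

definition cut_set :: "nat \<Rightarrow> (nat \<Rightarrow> nat) \<Rightarrow> real \<Rightarrow> 'j list set \<Rightarrow> bool" where
  "cut_set n \<omega> r A \<longleftrightarrow> finite A \<and>
    (\<forall>v\<in>A. word J v \<omega> \<and> a * r \<le> wratio c v \<omega> \<and> wratio c v \<omega> \<le> r) \<and>
    F \<omega> \<subseteq> (\<Union>v\<in>A. wmap S v \<omega> ` F (shift (length v) \<omega>)) \<and>
    disjoint_family_on (\<lambda>v. wmap S v \<omega> ` U) A \<and>
    (\<forall>s\<ge>0. (\<forall>k<n. (\<Sum>j\<in>J (\<omega> k). c (\<omega> k) j powr s) \<le> 1) \<longrightarrow> real (card A) \<le> (a * r) powr - s) \<and>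
    (\<forall>s\<ge>0. (\<forall>k<n. 1 \<le> (\<Sum>j\<in>J (\<omega> k). c (\<omega> k) j powr s)) \<longrightarrow> r powr - s \<le> real (card A))"

lemma
  assumes "cut_set n \<omega> r A"
  shows cut_set_finite: "finite A"
    and cut_set_word: "v \<in> A \<Longrightarrow> word J v \<omega>"
    and cut_set_ratio_ge: "v \<in> A \<Longrightarrow> a * r \<le> wratio c v \<omega>"
    and cut_set_ratio_le: "v \<in> A \<Longrightarrow> wratio c v \<omega> \<le> r"
    and cut_set_cover: "F \<omega> \<subseteq> (\<Union>v\<in>A. wmap S v \<omega> ` F (shift (length v) \<omega>))"
    and cut_set_disjoint: "disjoint_family_on (\<lambda>v. wmap S v \<omega> ` U) A"
    and cut_set_card_le: "0 \<le> s \<Longrightarrow> (\<And>k. k < n \<Longrightarrow> (\<Sum>j\<in>J (\<omega> k). c (\<omega> k) j powr s) \<le> 1) \<Longrightarrow>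
      real (card A) \<le> (a * r) powr - s"
    and cut_set_card_ge: "0 \<le> s \<Longrightarrow> (\<And>k. k < n \<Longrightarrow> 1 \<le> (\<Sum>j\<in>J (\<omega> k). c (\<omega> k) j powr s)) \<Longrightarrow>
      r powr - s \<le> real (card A)"
  using assms unfolding cut_set_def by blast+

lemma cut_set_Nil:
  assumes "1 \<le> r" "r < 1 / a"
  shows "cut_set n \<omega> r {[]}"
proof -
  have r: "0 < a * r" "a * r \<le> 1"
    using assms a_pos by (auto simp: field_simps)
  have "1 \<le> (a * r) powr - s" if "0 \<le> s" for s
  proof -
    have "0 < (a * r) powr s" using a_pos assms(1) by simp
    moreover have "(a * r) powr s \<le> 1" using powr_le1[OF that, of "a * r"] r by simp
    ultimately show ?thesis unfolding powr_minus by (rule one_le_inverse)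
  qed
  moreover have "r powr - s \<le> 1" if "0 \<le> s" for s
    using ge_one_powr_ge_zero[OF assms(1) that] by (simp add: powr_minus inverse_le_1_iff)
  ultimately show ?thesis
    using assms r by (auto simp: cut_set_def disjoint_family_on_def)
qed

text \<open>
  Prefixing the letter \<open>j\<close> multiplies ratios by \<open>c (\<omega> 0) j\<close>, so the words after \<open>j\<close> must be cut at
  level \<open>r / c (\<omega> 0) j\<close>. Disjointness is inherited from the injectivity of each first map and from the
  open set condition for different first maps. The counts obey
  \<open>(r / c) powr - s = r powr - s * c powr s\<close>, whose sum over \<open>j\<close> brings in the sum of the first-level weights.
\<close>

lemma cut_set_Cons:
  assumes \<omega>: "\<omega> \<in> UNIV \<rightarrow> L" and r: "0 < r"
    and A: "\<And>j. j \<in> J (\<omega> 0) \<Longrightarrow> cut_set n (shift 1 \<omega>) (r / c (\<omega> 0) j) (A j)"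
  shows "cut_set (Suc n) \<omega> r (\<Union>j\<in>J (\<omega> 0). (#) j ` A j)"
proof -
  let ?B = "\<Union>j\<in>J (\<omega> 0). (#) j ` A j"
  note \<omega>' = shift_in_Pi[OF \<omega>, of 1]
  have \<omega>0: "\<omega> 0 \<in> L" using \<omega> by auto
  have cpos: "0 < c (\<omega> 0) j" if "j \<in> J (\<omega> 0)" for j
    using cube_sim_pos[OF sim[OF \<omega>0 that]] .
  have fin: "finite ?B"
    using cut_set_finite[OF A] finite_J[OF \<omega>0] by blast
  have ratio: "word J v \<omega> \<and> a * r \<le> wratio c v \<omega> \<and> wratio c v \<omega> \<le> r" if "v \<in> ?B" for v
  proof -
    from that obtain j u where j: "j \<in> J (\<omega> 0)" and u: "u \<in> A j" and v: "v = j # u"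
      by blast
    have "word J u (shift 1 \<omega>)" "a * (r / c (\<omega> 0) j) \<le> wratio c u (shift 1 \<omega>)"
      "wratio c u (shift 1 \<omega>) \<le> r / c (\<omega> 0) j"
      using cut_set_word[OF A[OF j] u] cut_set_ratio_ge[OF A[OF j] u] cut_set_ratio_le[OF A[OF j] u] .
    then show ?thesis
      using cpos[OF j] j by (simp add: v field_simps)
  qed
  have cover: "F \<omega> \<subseteq> (\<Union>v\<in>?B. wmap S v \<omega> ` F (shift (length v) \<omega>))"
  proof
    fix x assume "x \<in> F \<omega>"
    then obtain j y where j: "j \<in> J (\<omega> 0)" and y: "y \<in> F (shift 1 \<omega>)" and x: "x = S (\<omega> 0) j y"
      using attractor_self_similar[OF \<omega>] by blast
    obtain u where u: "u \<in> A j" "y \<in> wmap S u (shift 1 \<omega>) ` F (shift (length u) (shift 1 \<omega>))"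
      using cut_set_cover[OF A[OF j]] y by blast
    then have "x \<in> wmap S (j # u) \<omega> ` F (shift (length (j # u)) \<omega>)"
      using x by auto
    then show "x \<in> (\<Union>v\<in>?B. wmap S v \<omega> ` F (shift (length v) \<omega>))"
      using j u(1) by blast
  qed
  have disj: "disjoint_family_on (\<lambda>v. wmap S v \<omega> ` U) ?B"
    unfolding disjoint_family_on_def
  proof (intro ballI impI)
    fix v v' assume v: "v \<in> ?B" and v': "v' \<in> ?B" and ne: "v \<noteq> v'"
    from v obtain j u where j: "j \<in> J (\<omega> 0)" "u \<in> A j" "v = j # u"
      by blast
    from v' obtain j' u' where j': "j' \<in> J (\<omega> 0)" "u' \<in> A j'" "v' = j' # u'"
      by blast
    have sub: "wmap S u (shift 1 \<omega>) ` U \<subseteq> U" "wmap S u' (shift 1 \<omega>) ` U \<subseteq> U"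
      using word_U[OF \<omega>'] cut_set_word[OF A[OF j(1)] j(2)] cut_set_word[OF A[OF j'(1)] j'(2)] by blast+
    show "wmap S v \<omega> ` U \<inter> wmap S v' \<omega> ` U = {}"
    proof (cases "j = j'")
      case True
      then have "wmap S u (shift 1 \<omega>) ` U \<inter> wmap S u' (shift 1 \<omega>) ` U = {}"
        using cut_set_disjoint[OF A[OF j(1)]] j j' ne unfolding disjoint_family_on_def by blast
      then have "S (\<omega> 0) j ` wmap S u (shift 1 \<omega>) ` U \<inter> S (\<omega> 0) j ` wmap S u' (shift 1 \<omega>) ` U = {}"
        using inj_on_image_Int[OF cube_sim_inj_on[OF sim[OF \<omega>0 j(1)]]] sub U_cube
        by (metis image_empty order_trans)
      then show ?thesis using j j' True by (simp add: image_comp)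
    next
      case False
      then have "S (\<omega> 0) j ` U \<inter> S (\<omega> 0) j' ` U = {}"
        using S_disjoint[OF \<omega>0] j j' by (auto simp: disjoint_family_on_def)
      moreover have "wmap S v \<omega> ` U \<subseteq> S (\<omega> 0) j ` U" "wmap S v' \<omega> ` U \<subseteq> S (\<omega> 0) j' ` U"
        using sub j(3) j'(3) by auto
      ultimately show ?thesis by blast
    qed
  qed
  have "card ?B = (\<Sum>j\<in>J (\<omega> 0). card ((#) j ` A j))"
    using cut_set_finite[OF A] finite_J[OF \<omega>0] by (intro card_UN_disjoint) auto
  then have card: "real (card ?B) = (\<Sum>j\<in>J (\<omega> 0). real (card (A j)))"
    by (simp add: card_image)
  have upper: "real (card ?B) \<le> (a * r) powr - s"
    if s: "0 \<le> s" and sums: "\<forall>k<Suc n. (\<Sum>j\<in>J (\<omega> k). c (\<omega> k) j powr s) \<le> 1" for s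
  proof -
    have "real (card (A j)) \<le> (a * r) powr - s * c (\<omega> 0) j powr s" if j: "j \<in> J (\<omega> 0)" for j
    proof -
      have "real (card (A j)) \<le> (a * (r / c (\<omega> 0) j)) powr - s"
        using sums by (intro cut_set_card_le[OF A[OF j] s]) (auto simp: shift_def)
      also have "\<dots> = (a * r) powr - s * c (\<omega> 0) j powr s"
        using divide_powr_minus[of "a * r"] cpos[OF j] a_pos r by simp
      finally show ?thesis .
    qed
    then have "real (card ?B) \<le> (\<Sum>j\<in>J (\<omega> 0). (a * r) powr - s * c (\<omega> 0) j powr s)"
      unfolding card by (rule sum_mono)
    also have "\<dots> = (a * r) powr - s * (\<Sum>j\<in>J (\<omega> 0). c (\<omega> 0) j powr s)"
      by (rule sum_distrib_left[symmetric])
    also have "\<dots> \<le> (a * r) powr - s"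
      using sums by (intro mult_left_le) auto
    finally show ?thesis .
  qed
  have lower: "r powr - s \<le> real (card ?B)"
    if s: "0 \<le> s" and sums: "\<forall>k<Suc n. 1 \<le> (\<Sum>j\<in>J (\<omega> k). c (\<omega> k) j powr s)" for s
  proof -
    have "r powr - s * c (\<omega> 0) j powr s \<le> real (card (A j))" if j: "j \<in> J (\<omega> 0)" for j
    proof -
      have "r powr - s * c (\<omega> 0) j powr s = (r / c (\<omega> 0) j) powr - s"
        using cpos[OF j] r by (simp add: divide_powr_minus)
      also have "\<dots> \<le> real (card (A j))"
        using sums by (intro cut_set_card_ge[OF A[OF j] s]) (auto simp: shift_def)
      finally show ?thesis .
    qed
    then have "(\<Sum>j\<in>J (\<omega> 0). r powr - s * c (\<omega> 0) j powr s) \<le> real (card ?B)"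
      unfolding card by (rule sum_mono)
    then have "r powr - s * (\<Sum>j\<in>J (\<omega> 0). c (\<omega> 0) j powr s) \<le> real (card ?B)"
      by (simp only: sum_distrib_left)
    moreover have "r powr - s * 1 \<le> r powr - s * (\<Sum>j\<in>J (\<omega> 0). c (\<omega> 0) j powr s)"
      using sums by (intro mult_left_mono) auto
    ultimately show ?thesis by simp
  qed
  show ?thesis
    unfolding cut_set_def using fin ratio cover disj upper lower by blast
qed

text \<open>
  The level may exceed 1, because dividing by a ratio in the recursion can overshoot, but it stays
  below \<open>1 / a\<close>; this keeps the ratios of the words at least \<open>a * r\<close>. Since \<open>b ^ n \<le> r\<close>, the recursion
  ends after at most \<open>n\<close> letters, and so the counts only involve the first \<open>n\<close> letters of \<open>\<omega>\<close>.
\<close>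

lemma cut_set_exists:
  assumes "\<omega> \<in> UNIV \<rightarrow> L" "0 < r" "r < 1 / a" "b ^ n \<le> r"
  shows "\<exists>A. cut_set n \<omega> r A"
  using assms
proof (induction n arbitrary: \<omega> r)
  case 0
  then have "1 \<le> r" by simp
  then show ?case using cut_set_Nil 0 by blast
next
  case (Suc n)
  show ?case
  proof (cases "1 \<le> r")
    case True
    then show ?thesis using cut_set_Nil Suc.prems by blast
  next
    case False
    note \<omega>' = shift_in_Pi[OF Suc.prems(1), of 1]
    have \<omega>0: "\<omega> 0 \<in> L" using Suc.prems by auto
    have "\<exists>A. cut_set n (shift 1 \<omega>) (r / c (\<omega> 0) j) A" if j: "j \<in> J (\<omega> 0)" for j
    proof (rule Suc.IH[OF \<omega>'])
      have c: "0 < c (\<omega> 0) j" "a \<le> c (\<omega> 0) j" "c (\<omega> 0) j \<le> b"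
        using cube_sim_pos[OF sim[OF \<omega>0 j]] a_le[OF \<omega>0 j] le_b[OF \<omega>0 j] by auto
      show "0 < r / c (\<omega> 0) j" using c Suc.prems by simp
      have "r / c (\<omega> 0) j < 1 / c (\<omega> 0) j"
        using False c by (simp add: divide_strict_right_mono)
      also have "\<dots> \<le> 1 / a" using c a_pos by (simp add: frac_le)
      finally show "r / c (\<omega> 0) j < 1 / a" .
      have "b ^ n * c (\<omega> 0) j \<le> b ^ n * b"
        using c b_pos by (intro mult_left_mono) auto
      also have "\<dots> \<le> r" using Suc.prems(4) by (simp add: mult.commute)
      finally show "b ^ n \<le> r / c (\<omega> 0) j"
        using c by (simp add: pos_le_divide_eq)
    qed
    then obtain A where "\<And>j. j \<in> J (\<omega> 0) \<Longrightarrow> cut_set n (shift 1 \<omega>) (r / c (\<omega> 0) j) (A j)"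
      by metis
    then show ?thesis using cut_set_Cons Suc.prems by blast
  qed
qed

end

section \<open>Covering numbers\<close>

lemma covering_number_le:
  assumes "finite \<U>" "F \<subseteq> \<Union>\<U>" "\<And>W. W \<in> \<U> \<Longrightarrow> bounded W \<and> diameter W \<le> r"
  shows "covering_number r F \<le> card \<U>"
  unfolding covering_number_def using assms by (intro Least_le) blast

text \<open>
  Total boundedness provides a finite cover, so the least cardinality is that of an actual cover.
\<close>

lemma covering_number_attained:
  fixes F :: "'a::euclidean_space set"
  assumes "bounded F" "0 < r"
  obtains \<U> where "finite \<U>" "card \<U> = covering_number r F" "F \<subseteq> \<Union>\<U>"
    "\<And>W. W \<in> \<U> \<Longrightarrow> bounded W \<and> diameter W \<le> r"
proof -
  have "compact (closure F)"
    using assms by simp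
  then obtain K where K: "finite K" "closure F \<subseteq> (\<Union>x\<in>K. ball x (r / 2))"
    unfolding compact_eq_totally_bounded using assms(2) half_gt_zero by blast
  have "\<exists>n \<U>. finite \<U> \<and> card \<U> = n \<and> F \<subseteq> \<Union>\<U> \<and> (\<forall>W\<in>\<U>. bounded W \<and> diameter W \<le> r)"
    using K assms(2) closure_subset[of F]
    by (intro exI[of _ "card ((\<lambda>x. ball x (r / 2)) ` K)"] exI[of _ "(\<lambda>x. ball x (r / 2)) ` K"])
      (auto simp: diameter_ball)
  from LeastI_ex[OF this] show ?thesis
    using that unfolding covering_number_def[symmetric] by blast
qed

lemma dist_unit_cube_le:
  fixes x y :: "real ^ 'n::finite"
  assumes "x \<in> unit_cube" "y \<in> unit_cube"
  shows "dist x y \<le> real CARD('n)"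
proof -
  have "dist x y \<le> (\<Sum>i\<in>UNIV. \<bar>(x - y) $ i\<bar>)"
    unfolding dist_norm by (rule norm_le_l1_cart)
  also have "\<dots> \<le> (\<Sum>i\<in>(UNIV :: 'n set). 1)"
    using assms by (intro sum_mono) (auto simp: unit_cube_eq abs_le_iff algebra_simps intro: add_mono order_trans)
  finally show ?thesis by simp
qed

context separated_RIFS
begin

section \<open>Multiplicity of separated cylinders\<close>

text \<open>
  Bounds how many essentially disjoint cylinders of size about \<open>T\<close> come within distance \<open>T\<close> of a point.
  The cube has diameter at most \<open>CARD('n)\<close>, which accounts for the distance between a point of a cylinder
  and the centre of its inscribed ball.
\<close>

definition multiplicity_bound :: real where
  "multiplicity_bound = ((1 + real CARD('n) + a * e) / (a * e)) ^ CARD('n)"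

lemma multiplicity_bound_pos: "0 < multiplicity_bound"
  using a_pos e_pos by (simp add: multiplicity_bound_def add_pos_pos)

text \<open>
  Each image of \<open>U\<close> contains a ball of radius \<open>a * T * e\<close>; these are disjoint and their centres
  are within \<open>T + T * CARD('n)\<close> of \<open>y\<close>.
\<close>

lemma card_separated_le:
  assumes fin: "finite A" and T: "0 < T"
    and g: "\<And>v. v \<in> A \<Longrightarrow> cube_sim (g v) (q v)"
    and q: "\<And>v. v \<in> A \<Longrightarrow> a * T \<le> q v \<and> q v \<le> T"
    and disj: "disjoint_family_on (\<lambda>v. g v ` U) A"
    and near: "\<And>v. v \<in> A \<Longrightarrow> \<exists>x\<in>unit_cube. dist y (g v x) \<le> T"
  shows "real (card A) \<le> multiplicity_bound"
proof -
  have zU: "z \<in> U" using ball_U e_pos by auto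
  have z: "z \<in> unit_cube" using zU U_cube by auto
  let ?r = "a * T * e" and ?L = "T + T * real CARD('n)"
  have ball: "ball (g v z) ?r \<subseteq> g v ` U" if v: "v \<in> A" for v
  proof -
    have "ball (g v z) ?r \<subseteq> ball (g v z) (q v * e)"
      using q[OF v] e_pos by (intro subset_ball) simp
    also have "\<dots> = g v ` ball z e"
      using cube_sim_image_ball[OF g[OF v] _ e_pos, of z] ball_U U_cube by auto
    finally show ?thesis using ball_U by blast
  qed
  have "real (card A) \<le> ((?L + ?r) / ?r) ^ DIM(real ^ 'n)"
  proof (rule card_disjoint_balls_le[OF fin])
    show "0 < ?r" "0 \<le> ?L" using a_pos T e_pos by auto
    show "disjoint_family_on (\<lambda>v. ball (g v z) ?r) A"
      unfolding disjoint_family_on_def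
    proof (intro ballI impI)
      fix v v' assume v: "v \<in> A" "v' \<in> A" "v \<noteq> v'"
      then have "g v ` U \<inter> g v' ` U = {}"
        using disj by (simp add: disjoint_family_on_def)
      then show "ball (g v z) ?r \<inter> ball (g v' z) ?r = {}"
        using ball[OF v(1)] ball[OF v(2)] by blast
    qed
    show "dist y (g v z) \<le> ?L" if v: "v \<in> A" for v
    proof -
      obtain x where x: "x \<in> unit_cube" "dist y (g v x) \<le> T" using near[OF v] by blast
      have "dist (g v x) (g v z) \<le> T * real CARD('n)"
        unfolding cube_sim_dist[OF g[OF v] x(1) z]
        using q[OF v] T dist_unit_cube_le[OF x(1) z] by (intro mult_mono) auto
      then show ?thesis using x(2) dist_triangle[of y "g v z" "g v x"] by linarith
    qed
  qed
  also have "(?L + ?r) / ?r = (T * (1 + real CARD('n) + a * e)) / (T * (a * e))"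
    by (simp add: algebra_simps)
  also have "\<dots> = (1 + real CARD('n) + a * e) / (a * e)"
    using T by (subst mult_divide_mult_cancel_left) auto
  finally show ?thesis by (simp add: multiplicity_bound_def)
qed

lemma power_b_le:
  assumes "0 < t"
  obtains n where "b ^ n \<le> t"
  using real_arch_pow_inv[OF assms b_less_1] less_imp_le by blast

section \<open>Upper bound for the dimension\<close>

text \<open>
  Boundedly many cylinders of size about \<open>R\<close> meet the ball. Within each of them, the cylinders of
  relative size about \<open>r / (R * CARD('n))\<close> have diameter at most \<open>r\<close>, and there are at most a
  constant times \<open>(R / r) powr s\<close> of them. The constants depend neither on the point nor on \<open>\<omega>\<close>, because the bound on
  cut sets applies to every shift of \<open>\<omega>\<close>.
\<close>

lemma covering_number_attractor_le:
  assumes \<omega>: "\<omega> \<in> UNIV \<rightarrow> L" and s: "0 \<le> s"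
    and sums: "\<And>k. (\<Sum>j\<in>J (\<omega> k). c (\<omega> k) j powr s) \<le> 1"
    and r: "0 < r" "r < R" and R: "R \<le> 1"
  shows "real (covering_number r (cball x R \<inter> F \<omega>))
    \<le> multiplicity_bound * (a / real CARD('n)) powr - s * (R / r) powr s"
proof -
  let ?D = "real CARD('n)"
  have D: "1 \<le> ?D" by (simp add: Suc_le_eq)
  have one_less: "1 < 1 / a" using a_pos a_less_1 by simp
  obtain n where "b ^ n \<le> R" using power_b_le[of R] r by auto
  then obtain A where A: "cut_set n \<omega> R A"
    using cut_set_exists[OF \<omega>, of R n] r R one_less by auto
  define A' where "A' = {v \<in> A. \<exists>y\<in>unit_cube. dist x (wmap S v \<omega> y) \<le> R}"
  have A': "finite A'" "A' \<subseteq> A" using cut_set_finite[OF A] by (auto simp: A'_def)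
  have cardA': "real (card A') \<le> multiplicity_bound"
  proof (rule card_separated_le[OF A'(1), of R "\<lambda>v. wmap S v \<omega>" "\<lambda>v. wratio c v \<omega>" x])
    show "disjoint_family_on (\<lambda>v. wmap S v \<omega> ` U) A'"
      using disjoint_family_on_mono[OF A'(2) cut_set_disjoint[OF A]] .
  next
    fix v assume "v \<in> A'"
    then have v: "v \<in> A" using A' by blast
    show "cube_sim (wmap S v \<omega>) (wratio c v \<omega>)" by (rule word_sim[OF \<omega> cut_set_word[OF A v]])
    show "a * R \<le> wratio c v \<omega> \<and> wratio c v \<omega> \<le> R"
      using cut_set_ratio_ge[OF A v] cut_set_ratio_le[OF A v] ..
  qed (use r in \<open>auto simp: A'_def\<close>)
  define d where "d = r / (R * ?D)"
  have d: "0 < d" "d < 1"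
  proof -
    have "R * 1 \<le> R * ?D" using D r by (intro mult_left_mono) auto
    then have "r < R * ?D" using r by linarith
    then show "0 < d" "d < 1" using r by (auto simp: d_def)
  qed
  obtain m where "b ^ m \<le> d" using power_b_le[OF d(1)] .
  then have "\<exists>B. cut_set m (shift (length v) \<omega>) d B" for v :: "'j list"
    using cut_set_exists[OF shift_in_Pi[OF \<omega>], of d m] d one_less by auto
  then obtain B where B: "\<And>v :: 'j list. cut_set m (shift (length v) \<omega>) d (B v)" by metis
  have cardB: "real (card (B v)) \<le> (a * d) powr - s" for v
    using sums by (intro cut_set_card_le[OF B s]) (simp add: shift_def)
  define piece where "piece = (\<lambda>(v, u). wmap S v \<omega> ` wmap S u (shift (length v) \<omega>) `
    F (shift (length u) (shift (length v) \<omega>)))"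
  have fin: "finite (Sigma A' B)"
    using A' cut_set_finite[OF B] by blast
  have "covering_number r (cball x R \<inter> F \<omega>) \<le> card (piece ` Sigma A' B)"
  proof (rule covering_number_le)
    show "finite (piece ` Sigma A' B)" using fin by simp
    show "cball x R \<inter> F \<omega> \<subseteq> \<Union> (piece ` Sigma A' B)"
    proof
      fix y assume y: "y \<in> cball x R \<inter> F \<omega>"
      then obtain v y' where v: "v \<in> A" "y' \<in> F (shift (length v) \<omega>)" "y = wmap S v \<omega> y'"
        using cut_set_cover[OF A] by blast
      have "v \<in> A'"
        using v y attractor_subset_cube[OF shift_in_Pi[OF \<omega>]] by (auto simp: A'_def)
      moreover obtain u where "u \<in> B v"
        "y' \<in> wmap S u (shift (length v) \<omega>) ` F (shift (length u) (shift (length v) \<omega>))"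
        using cut_set_cover[OF B[of v]] v(2) by blast
      ultimately show "y \<in> \<Union> (piece ` Sigma A' B)"
        using v(3) by (auto simp: piece_def simp del: shift_shift)
    qed
  next
    fix W assume "W \<in> piece ` Sigma A' B"
    then obtain v u where v: "v \<in> A'" and u: "u \<in> B v" and W: "W = piece (v, u)" by auto
    let ?\<omega>' = "shift (length v) \<omega>"
    have v': "word J v \<omega>" "wratio c v \<omega> \<le> R" 
      using cut_set_word[OF A] cut_set_ratio_le[OF A] v A' by blast+
    have u': "word J u ?\<omega>'" "wratio c u ?\<omega>' \<le> d" 
      using cut_set_word[OF B u] cut_set_ratio_le[OF B u] .
    have sim: "cube_sim (wmap S v \<omega> \<circ> wmap S u ?\<omega>') (wratio c v \<omega> * wratio c u ?\<omega>')"
      using word_sim[OF \<omega> v'(1)] word_sim[OF shift_in_Pi[OF \<omega>] u'(1)] by (rule cube_sim_compose)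
    have pos: "0 < wratio c v \<omega>" "0 < wratio c u ?\<omega>'"
      using cube_sim_pos[OF word_sim[OF \<omega> v'(1)]]
        cube_sim_pos[OF word_sim[OF shift_in_Pi[OF \<omega>] u'(1)]] by auto
    have W': "W \<subseteq> (wmap S v \<omega> \<circ> wmap S u ?\<omega>') ` unit_cube"
    proof -
      have "F (shift (length u) ?\<omega>') \<subseteq> unit_cube"
        by (intro attractor_subset_cube shift_in_Pi \<omega>)
      then show ?thesis
        unfolding W piece_def by (auto simp: image_comp simp del: shift_shift)
    qed
    have close: "norm (y - y') \<le> r" if yy: "y \<in> W" "y' \<in> W" for y y'
    proof -
      obtain w w' where w: "w \<in> unit_cube" "w' \<in> unit_cube"
        "y = (wmap S v \<omega> \<circ> wmap S u ?\<omega>') w" "y' = (wmap S v \<omega> \<circ> wmap S u ?\<omega>') w'"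
        using yy W' by blast
      have "dist y y' = wratio c v \<omega> * wratio c u ?\<omega>' * dist w w'"
        unfolding w(3,4) by (rule cube_sim_dist[OF sim w(1,2)])
      also have "\<dots> \<le> R * d * ?D"
        using v' u' pos d r dist_unit_cube_le[OF w(1,2)] by (intro mult_mono) auto
      also have "\<dots> = r" using r D by (simp add: d_def)
      finally show ?thesis by (simp add: dist_norm)
    qed
    show "bounded W \<and> diameter W \<le> r"
    proof
      have "W \<subseteq> unit_cube"
        using W' cube_sim_maps[OF sim] by blast
      then show "bounded W"
        using compact_unit_cube compact_imp_bounded bounded_subset by blast
      show "diameter W \<le> r" using close r by (intro diameter_le) auto
    qed
  qed
  also have "\<dots> \<le> card (Sigma A' B)" by (rule card_image_le[OF fin])
  also have "\<dots> = (\<Sum>v\<in>A'. card (B v))"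
    using A' cut_set_finite[OF B] by (intro card_SigmaI) auto
  finally have "real (covering_number r (cball x R \<inter> F \<omega>)) \<le> (\<Sum>v\<in>A'. real (card (B v)))"
    by (simp flip: of_nat_sum)
  also have "\<dots> \<le> real (card A') * (a * d) powr - s"
    by (rule sum_bounded_above) (rule cardB)
  also have "\<dots> \<le> multiplicity_bound * (a * d) powr - s"
    using cardA' by (intro mult_right_mono) auto
  also have "a * d = (a / ?D) / (R / r)" by (simp add: d_def)
  also have "\<dots> powr - s = (a / ?D) powr - s * (R / r) powr s"
    using a_pos r D by (intro divide_powr_minus) auto
  finally show ?thesis by (simp add: mult.assoc)
qed

section \<open>Lower bound from long runs\<close>

text \<open>
  Inside a long and late run of the letter \<open>i\<close>, below a cylinder of some size \<open>q\<close>, the attractor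
  looks down to relative scale \<open>t\<close> like that of the single system \<open>i\<close>. It thus has at least \<open>t powr - s\<close>
  cylinders of size about \<open>q * t\<close>, and a set of diameter at most \<open>q * t\<close> can meet only boundedly many of them.
  Comparing with the assumed covering bound for the radii \<open>q * CARD('n)\<close> and \<open>q * t\<close> gives an inequality
  that does not involve \<open>q\<close>.
\<close>

lemma count_in_runs:
  assumes \<omega>: "\<omega> \<in> UNIV \<rightarrow> L" and runs: "\<And>n. \<exists>k. \<forall>l<n. \<omega> (k + l) = i"
    and s: "0 \<le> s" "1 \<le> (\<Sum>j\<in>J i. c i j powr s)"
    and \<rho>: "0 < \<rho>" and C: "0 \<le> C"
    and cover: "\<And>r R x. 0 < r \<Longrightarrow> r < R \<Longrightarrow> R \<le> \<rho> \<Longrightarrow> x \<in> F \<omega> \<Longrightarrow>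
      real (covering_number r (cball x R \<inter> F \<omega>)) \<le> C * (R / r) powr \<alpha>"
    and t: "0 < t" "t < 1"
  shows "t powr - s \<le> multiplicity_bound * C * (real CARD('n) / t) powr \<alpha>"
proof -
  let ?D = "real CARD('n)"
  have D: "1 \<le> ?D" by (simp add: Suc_le_eq)
  have one_less: "1 < 1 / a" using a_pos a_less_1 by simp
  obtain n where n: "b ^ n \<le> t" using power_b_le[OF t(1)] .
  obtain k0 where k0: "b ^ k0 \<le> \<rho> / ?D" using power_b_le[of "\<rho> / ?D"] \<rho> D by auto
  \<comment> \<open>The first \<open>k0\<close> letters of the run are skipped: they force the enclosing cylinder below the scale \<open>\<rho>\<close>.\<close>
  obtain k1 where k1: "\<And>l. l < k0 + n \<Longrightarrow> \<omega> (k1 + l) = i" using runs[of "k0 + n"] by blast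
  define k where "k = k1 + k0"
  define \<omega>' where "\<omega>' = shift k \<omega>"
  have \<omega>': "\<omega>' \<in> UNIV \<rightarrow> L" unfolding \<omega>'_def by (rule shift_in_Pi[OF \<omega>])
  have run: "\<omega>' l = i" if "l < n" for l
    using k1[of "k0 + l"] that by (simp add: \<omega>'_def shift_def k_def add.assoc)
  obtain u where u: "word J u \<omega>" "length u = k" "wratio c u \<omega> \<le> b ^ k" using obtain_word[OF \<omega>] .
  define q where "q = wratio c u \<omega>"
  note simu = word_sim[OF \<omega> u(1), folded q_def]
  have q: "0 < q" using cube_sim_pos[OF simu] .
  have "b ^ k \<le> b ^ k0"
    using b_pos b_less_1 by (intro power_decreasing) (auto simp: k_def)
  then have "q \<le> \<rho> / ?D"
    using u(3) k0 by (simp add: q_def)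
  then have q\<rho>: "q * ?D \<le> \<rho>"
    using D by (simp add: pos_le_divide_eq)
  obtain A where A: "cut_set n \<omega>' t A"
    using cut_set_exists[OF \<omega>' t(1) _ n] t(2) one_less by auto
  note fin = cut_set_finite[OF A]
  have wordA: "word J v \<omega>'" "a * t \<le> wratio c v \<omega>'" "wratio c v \<omega>' \<le> t" if "v \<in> A" for v
    using cut_set_word[OF A that] cut_set_ratio_ge[OF A that] cut_set_ratio_le[OF A that] .
  have large: "t powr - s \<le> real (card A)"
    using s(2) run by (intro cut_set_card_ge[OF A s(1)]) simp
  have "\<forall>v :: 'j list. \<exists>y. y \<in> F (shift (length v) \<omega>')"
    using attractor_nonempty[OF shift_in_Pi[OF \<omega>']] by blast
  then obtain p where p: "\<And>v :: 'j list. p v \<in> F (shift (length v) \<omega>')" by metis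
  have pcube: "p v \<in> unit_cube" for v
    using p attractor_subset_cube[OF shift_in_Pi[OF \<omega>']] by blast
  define y where "y v = wmap S u \<omega> (wmap S v \<omega>' (p v))" for v
  have inner: "wmap S v \<omega>' (p v) \<in> F \<omega>'" if "v \<in> A" for v
    using word_attractor[OF \<omega>' wordA(1)[OF that]] p by blast
  have outer: "wmap S u \<omega> x \<in> F \<omega>" if "x \<in> F \<omega>'" for x
    using word_attractor[OF \<omega> u(1)] that by (auto simp: u(2) \<omega>'_def)
  note F_cube = attractor_subset_cube[OF \<omega>', THEN subsetD]
  obtain x0 where x0: "x0 \<in> F \<omega>'" using attractor_nonempty[OF \<omega>'] by blast
  let ?x = "wmap S u \<omega> x0"
  have near: "y v \<in> cball ?x (q * ?D) \<inter> F \<omega>" if v: "v \<in> A" for v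
  proof -
    have "dist ?x (y v) = q * dist x0 (wmap S v \<omega>' (p v))"
      unfolding y_def by (rule cube_sim_dist[OF simu F_cube[OF x0] F_cube[OF inner[OF v]]])
    also have "\<dots> \<le> q * ?D"
      using q dist_unit_cube_le[OF F_cube[OF x0] F_cube[OF inner[OF v]]] by simp
    finally show ?thesis using outer[OF inner[OF v]] by (simp add: y_def)
  qed
  have r: "0 < q * t" using q t by simp
  have "bounded (cball ?x (q * ?D) \<inter> F \<omega>)" by (simp add: bounded_Int)
  then obtain \<U> where \<U>: "finite \<U>"
      "card \<U> = covering_number (q * t) (cball ?x (q * ?D) \<inter> F \<omega>)"
      "cball ?x (q * ?D) \<inter> F \<omega> \<subseteq> \<Union>\<U>"
      "\<And>W. W \<in> \<U> \<Longrightarrow> bounded W \<and> diameter W \<le> q * t"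
    using covering_number_attained[OF _ r] by blast
  have few: "real (card {v \<in> A. y v \<in> W}) \<le> multiplicity_bound" if W: "W \<in> \<U>" for W
  proof (cases "{v \<in> A. y v \<in> W} = {}")
    case True
    show ?thesis unfolding True using multiplicity_bound_pos by simp
  next
    case False
    then obtain v0 where v0: "v0 \<in> A" "y v0 \<in> W" by blast
    show ?thesis
    proof (rule card_separated_le[OF _ r, of _ "\<lambda>v. wmap S u \<omega> \<circ> wmap S v \<omega>'"
          "\<lambda>v. q * wratio c v \<omega>'" "y v0"])
      show "finite {v \<in> A. y v \<in> W}" using fin by simp
    next
      fix v assume "v \<in> {v \<in> A. y v \<in> W}"
      then have v: "v \<in> A" "y v \<in> W" by auto
      show "cube_sim (wmap S u \<omega> \<circ> wmap S v \<omega>') (q * wratio c v \<omega>')"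
        by (rule cube_sim_compose[OF simu word_sim[OF \<omega>' wordA(1)[OF v(1)]]])
      show "a * (q * t) \<le> q * wratio c v \<omega>' \<and> q * wratio c v \<omega>' \<le> q * t"
        using wordA(2,3)[OF v(1)] q by (simp add: mult.left_commute[of a])
      have "dist (y v0) (y v) \<le> q * t"
        using diameter_bounded_bound[of W "y v0" "y v"] \<U>(4)[OF W] v v0 by linarith
      then show "\<exists>x\<in>unit_cube. dist (y v0) ((wmap S u \<omega> \<circ> wmap S v \<omega>') x) \<le> q * t"
        using pcube[of v] by (auto simp: y_def)
    next
      show "disjoint_family_on (\<lambda>v. (wmap S u \<omega> \<circ> wmap S v \<omega>') ` U) {v \<in> A. y v \<in> W}"
        unfolding disjoint_family_on_def
      proof (intro ballI impI)
        fix v v' assume "v \<in> {v \<in> A. y v \<in> W}" "v' \<in> {v \<in> A. y v \<in> W}" "v \<noteq> v'"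
        then have v: "v \<in> A" "v' \<in> A" "v \<noteq> v'" by auto
        have "wmap S v \<omega>' ` U \<inter> wmap S v' \<omega>' ` U = {}"
          using cut_set_disjoint[OF A] v unfolding disjoint_family_on_def by blast
        moreover have "wmap S v \<omega>' ` U \<subseteq> unit_cube" "wmap S v' \<omega>' ` U \<subseteq> unit_cube"
          using word_U[OF \<omega>' wordA(1)] v U_cube by blast+
        ultimately have "wmap S u \<omega> ` wmap S v \<omega>' ` U \<inter> wmap S u \<omega> ` wmap S v' \<omega>' ` U = {}"
          using inj_on_image_Int[OF cube_sim_inj_on[OF simu]] by (metis image_empty)
        then show "(wmap S u \<omega> \<circ> wmap S v \<omega>') ` U \<inter> (wmap S u \<omega> \<circ> wmap S v' \<omega>') ` U = {}"
          by (simp add: image_comp)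
      qed
    qed
  qed
  have "A = (\<Union>W\<in>\<U>. {v \<in> A. y v \<in> W})"
    using near \<U>(3) by blast
  then have "card A \<le> (\<Sum>W\<in>\<U>. card {v \<in> A. y v \<in> W})"
    using card_UN_le[OF \<U>(1), of "\<lambda>W. {v \<in> A. y v \<in> W}"] by simp
  then have "real (card A) \<le> (\<Sum>W\<in>\<U>. real (card {v \<in> A. y v \<in> W}))"
    by (simp flip: of_nat_sum)
  also have "\<dots> \<le> real (card \<U>) * multiplicity_bound"
    by (rule sum_bounded_above) (rule few)
  also have "\<dots> \<le> C * ((q * ?D) / (q * t)) powr \<alpha> * multiplicity_bound"
  proof (rule mult_right_mono)
    show "real (card \<U>) \<le> C * ((q * ?D) / (q * t)) powr \<alpha>"
    proof -
      have "t < ?D" using t D by linarith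
      then show ?thesis
        unfolding \<U>(2) using q t q\<rho> outer[OF x0] by (intro cover) auto
    qed
  qed (use multiplicity_bound_pos in simp)
  also have "(q * ?D) / (q * t) = ?D / t" using q by simp
  finally show ?thesis using large by (simp add: mult_ac)
qed

text \<open>
  If \<open>\<alpha> < s\<close>, the inequality of the preceding lemma fails as \<open>t\<close> tends to \<open>0\<close>.
\<close>

lemma exponent_ge_of_runs:
  assumes "\<omega> \<in> UNIV \<rightarrow> L" and "\<And>n. \<exists>k. \<forall>l<n. \<omega> (k + l) = i"
    and "0 \<le> s" "1 \<le> (\<Sum>j\<in>J i. c i j powr s)"
    and "0 < \<rho>" and C: "0 < C"
    and "\<And>r R x. 0 < r \<Longrightarrow> r < R \<Longrightarrow> R \<le> \<rho> \<Longrightarrow> x \<in> F \<omega> \<Longrightarrow>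
      real (covering_number r (cball x R \<inter> F \<omega>)) \<le> C * (R / r) powr \<alpha>"
  shows "s \<le> \<alpha>"
proof (rule ccontr)
  assume less: "\<not> s \<le> \<alpha>"
  define h where "h = s - \<alpha>"
  have h: "0 < h" using less by (simp add: h_def)
  define K where "K = multiplicity_bound * C * real CARD('n) powr \<alpha>"
  have K: "0 < K" using multiplicity_bound_pos C by (simp add: K_def)
  \<comment> \<open>With this choice, \<open>t powr - h\<close> equals \<open>K + 1\<close>, just above the bound \<open>K\<close>.\<close>
  define t where "t = (K + 1) powr (- 1 / h)"
  have t: "0 < t" "t < 1"
    using K h by (auto simp: t_def intro!: powr_less_one)
  have "t powr - s \<le> multiplicity_bound * C * (real CARD('n) / t) powr \<alpha>"
    using assms t by (intro count_in_runs) auto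
  also have "\<dots> = K * t powr - \<alpha>"
    using t by (simp add: K_def powr_divide powr_minus field_simps)
  finally have "t powr - h * t powr - \<alpha> \<le> K * t powr - \<alpha>"
    by (simp add: h_def flip: powr_add)
  then have "t powr - h \<le> K" using t by simp
  moreover have "t powr - h = K + 1"
    using h K by (simp add: t_def powr_powr)
  ultimately show False by simp
qed

text \<open>
  This determines both sides of the theorem: a constant sequence and a typical random sequence both
  contain arbitrarily long runs of a letter whose similarity dimension is the largest that occurs.
\<close>

lemma assouad_dim_attractor:
  assumes "\<omega> \<in> UNIV \<rightarrow> L" and "\<And>n. \<exists>k. \<forall>l<n. \<omega> (k + l) = i"
    and "0 \<le> s" "1 \<le> (\<Sum>j\<in>J i. c i j powr s)"
    and "\<And>k. (\<Sum>j\<in>J (\<omega> k). c (\<omega> k) j powr s) \<le> 1"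
  shows "assouad_dim (F \<omega>) = s"
  unfolding assouad_dim_def
proof (rule cInf_eq_minimum)
  let ?C = "multiplicity_bound * (a / real CARD('n)) powr - s"
  have "0 < ?C" using multiplicity_bound_pos a_pos by simp
  moreover have "\<forall>r R. 0 < r \<and> r < R \<and> R \<le> 1 \<longrightarrow>
      (\<forall>x\<in>F \<omega>. real (covering_number r (cball x R \<inter> F \<omega>)) \<le> ?C * (R / r) powr s)"
    using covering_number_attractor_le[OF assms(1,3,5)] by blast
  ultimately show "s \<in> {\<alpha>. \<alpha> \<ge> 0 \<and> (\<exists>C>0. \<exists>\<rho>>0. \<forall>r R. 0 < r \<and> r < R \<and> R \<le> \<rho> \<longrightarrow>
      (\<forall>x\<in>F \<omega>. real (covering_number r (cball x R \<inter> F \<omega>)) \<le> C * (R / r) powr \<alpha>))}"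
    using assms(3) zero_less_one by blast
next
  fix \<alpha> assume "\<alpha> \<in> {\<alpha>. \<alpha> \<ge> 0 \<and> (\<exists>C>0. \<exists>\<rho>>0. \<forall>r R. 0 < r \<and> r < R \<and> R \<le> \<rho> \<longrightarrow>
      (\<forall>x\<in>F \<omega>. real (covering_number r (cball x R \<inter> F \<omega>)) \<le> C * (R / r) powr \<alpha>))}"
  then obtain C \<rho> where "0 < C" "0 < \<rho>" "\<And>r R x. 0 < r \<Longrightarrow> r < R \<Longrightarrow> R \<le> \<rho> \<Longrightarrow> x \<in> F \<omega> \<Longrightarrow>
      real (covering_number r (cball x R \<inter> F \<omega>)) \<le> C * (R / r) powr \<alpha>"
    by blast
  then show "s \<le> \<alpha>" using exponent_ge_of_runs[OF assms(1-4)] by blast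
qed

end

section \<open>Long runs in random sequences\<close>

text \<open>
  Consider the consecutive blocks of length \<open>n\<close>. Splitting off the first block identifies the measure
  with its product with itself, so the event that none of the first \<open>m\<close> blocks is constantly \<open>i\<close> has
  probability \<open>x ^ m\<close>, where \<open>x < 1\<close> is its probability for a single block.
\<close>

lemma AE_bernoulli_run:
  assumes p: "probability_vector N p" and i: "i \<in> {1..N}"
  shows "AE \<omega> in bernoulli_measure N p. \<exists>k. \<forall>l<n. \<omega> (k + l) = i"
proof -
  interpret letter: prob_space "point_measure {1..N} (\<lambda>i. ennreal (p i))"
    by (rule prob_space_letter[OF p])
  interpret seq: sequence_space "point_measure {1..N} (\<lambda>i. ennreal (p i))"
    by unfold_locales
  define B where "B = bernoulli_measure N p"
  have B: "B = seq.S" by (simp add: B_def bernoulli_measure_def)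
  interpret B: prob_space B unfolding B by unfold_locales
  have [measurable]: "Measurable.pred B (\<lambda>\<omega>. \<omega> k = i)" for k
  proof -
    have "(\<lambda>\<omega>. \<omega> k) -` {i} \<inter> space B \<in> sets B"
      unfolding B using i by (intro measurable_sets[OF measurable_component_singleton])
        (auto simp: sets_point_measure)
    moreover have "(\<lambda>\<omega>. \<omega> k) -` {i} \<inter> space B = {\<omega> \<in> space B. \<omega> k = i}" by auto
    ultimately show ?thesis by (simp add: pred_def)
  qed
  define Q where "Q m = {\<omega> \<in> space B. \<forall>k<m. \<not> (\<forall>l<n. \<omega> (k * n + l) = i)}" for m
  define E where "E = {\<omega> \<in> space B. \<not> (\<forall>l<n. \<omega> l = i)}"
  have [measurable]: "Q m \<in> sets B" "E \<in> sets B" for m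
    unfolding Q_def E_def by measurable
  have "emeasure B (Q m) = emeasure B E ^ m" for m
  proof (induction m)
    case 0
    have "Q 0 = space B" by (simp add: Q_def)
    then show ?case using B.emeasure_space_1 by simp
  next
    case (Suc m)
    let ?f = "\<lambda>(\<omega>, \<omega>'). comb_seq n \<omega> \<omega>'"
    have f: "?f \<in> measurable (B \<Otimes>\<^sub>M B) B"
      unfolding B by (rule measurable_comb_seq)
    have "B = distr (B \<Otimes>\<^sub>M B) B ?f"
      unfolding B by (rule seq.PiM_comb_seq[symmetric])
    then have "emeasure B (Q (Suc m)) = emeasure (distr (B \<Otimes>\<^sub>M B) B ?f) (Q (Suc m))" by simp
    also have "\<dots> = emeasure (B \<Otimes>\<^sub>M B) (?f -` Q (Suc m) \<inter> space (B \<Otimes>\<^sub>M B))"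
      by (rule emeasure_distr[OF f]) measurable
    also have "?f -` Q (Suc m) \<inter> space (B \<Otimes>\<^sub>M B) = E \<times> Q m"
    proof -
      have first: "comb_seq n \<omega> \<omega>' l = \<omega> l" if "l < n" for \<omega> \<omega>' :: "nat \<Rightarrow> nat" and l
        using that by (rule comb_seq_less)
      have later: "comb_seq n \<omega> \<omega>' (n + (k * n + l)) = \<omega>' (k * n + l)" for \<omega> \<omega>' :: "nat \<Rightarrow> nat" and k l
        by (simp add: comb_seq_def)
      have "?f x \<in> space B" if "x \<in> space (B \<Otimes>\<^sub>M B)" for x
        using measurable_space[OF f that] .
      then show ?thesis
        by (auto simp: Q_def E_def space_pair_measure All_less_Suc2 first later add.assoc)
    qed
    also have "emeasure (B \<Otimes>\<^sub>M B) (E \<times> Q m) = emeasure B E * emeasure B (Q m)"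
      by (rule B.emeasure_pair_measure_Times) measurable
    finally show ?case using Suc.IH by simp
  qed
  then have "ennreal (B.prob (Q m)) = ennreal (B.prob E ^ m)" for m
    by (simp add: B.emeasure_eq_measure ennreal_power)
  then have prob_Q: "B.prob (Q m) = B.prob E ^ m" for m
    by simp
  have "B.prob E < 1"
  proof -
    have "space B - E = {\<omega> \<in> UNIV \<rightarrow> {1..N}. \<forall>l<n. \<omega> l = i}"
      by (auto simp: E_def B_def space_bernoulli_measure)
    then have "emeasure B (space B - E) = ennreal (\<Prod>l<n. p i)"
      using emeasure_bernoulli_measure_cylinder[OF p, of n "\<lambda>_. i"] i by (simp add: B_def)
    moreover have "0 < p i" using p i by (simp add: probability_vector_def)
    ultimately have "0 < emeasure B (space B - E)" by simp
    then have "0 < B.prob (space B - E)"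
      by (simp add: B.emeasure_eq_measure)
    then show ?thesis using B.prob_compl[of E] by simp
  qed
  then have lim: "(\<lambda>m. B.prob E ^ m) \<longlonglongrightarrow> 0"
    by (intro LIMSEQ_power_zero) simp
  let ?N = "{\<omega> \<in> space B. \<not> (\<exists>k. \<forall>l<n. \<omega> (k + l) = i)}"
  have "B.prob ?N \<le> B.prob E ^ m" for m
    unfolding prob_Q[symmetric] by (rule B.finite_measure_mono) (auto simp: Q_def)
  then have "B.prob ?N \<le> 0"
    by (intro LIMSEQ_le_const[OF lim]) auto
  then have "B.prob ?N = 0"
    using measure_nonneg[of B ?N] by linarith
  moreover have "?N \<in> B.events" by measurable
  ultimately have "AE \<omega> in B. \<omega> \<notin> ?N"
    using B.prob_eq_0 by blast
  moreover have "AE \<omega> in B. \<omega> \<in> space B" by (rule AE_space)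
  ultimately show ?thesis
    unfolding B_def[symmetric] by eventually_elim auto
qed

section \<open>The almost sure dimension\<close>

text \<open>
  The sum is continuous in \<open>s\<close>, is the number of maps at \<open>s = 0\<close>, and is small for large \<open>s\<close>.
  A family with a single map is included, with solution \<open>0\<close>.
\<close>

lemma moran_equation_solvable:
  fixes c :: "'j \<Rightarrow> real"
  assumes fin: "finite I" and ne: "I \<noteq> {}" and c: "\<And>j. j \<in> I \<Longrightarrow> 0 < c j \<and> c j < 1"
  obtains s where "0 \<le> s" "(\<Sum>j\<in>I. c j powr s) = 1"
proof -
  define b where "b = Max (c ` I)"
  have "b \<in> c ` I" unfolding b_def using fin ne by (intro Max_in) auto
  then have b: "0 < b" "b < 1" using c by auto
  have le_b: "c j \<le> b" if "j \<in> I" for j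
    using fin that by (simp add: b_def)
  have card: "0 < card I" using fin ne by (simp add: card_gt_0_iff)
  obtain n where n: "b ^ n < 1 / real (card I)"
    using real_arch_pow_inv[of "1 / real (card I)" b] b card by auto
  have "c j powr real n \<le> b ^ n" if "j \<in> I" for j
    using c[OF that] le_b[OF that] by (simp add: powr_realpow power_mono)
  then have "(\<Sum>j\<in>I. c j powr real n) \<le> real (card I) * b ^ n"
    by (rule sum_bounded_above)
  also have "\<dots> \<le> 1" using n card by (simp add: field_simps)
  finally have small: "(\<Sum>j\<in>I. c j powr real n) \<le> 1" .
  have "(\<Sum>j\<in>I. c j powr 0) = real (card I)"
    using c by (simp add: powr_zero_eq_one order_less_imp_not_eq2)
  then have large: "1 \<le> (\<Sum>j\<in>I. c j powr 0)" using card by simp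
  have "continuous_on {0..real n} (\<lambda>s. \<Sum>j\<in>I. c j powr s)"
    using c by (intro continuous_intros) force+
  from IVT2'[of "\<lambda>s. \<Sum>j\<in>I. c j powr s", OF small large _ this] show ?thesis
    using that by auto
qed

theorem theorem2p6:
  fixes N :: nat
    and J :: "nat \<Rightarrow> 'j set"
    and S :: "nat \<Rightarrow> 'j \<Rightarrow> real ^ 'n::finite \<Rightarrow> real ^ 'n"
    and p :: "nat \<Rightarrow> real"
  assumes "similarity_RIFS N J S"
    and "UOSC N J S"
    and "probability_vector N p"
  shows "AE \<omega> in bernoulli_measure N p.
    assouad_dim (random_attractor J S \<omega>) =
      Max ((\<lambda>i. assouad_dim (random_attractor J S (\<lambda>_. i))) ` {1..N})"
proof -
  let ?L = "{1..N}"
  have N: "1 \<in> ?L" and J: "\<And>i. i \<in> ?L \<Longrightarrow> finite (J i) \<and> J i \<noteq> {}"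
    using assms(1) by (auto simp: similarity_RIFS_def)
  have "\<exists>r. cube_sim (S i j) r \<and> r < 1" if "i \<in> ?L" "j \<in> J i" for i j
    using assms(1) that unfolding similarity_RIFS_def contracting_similarity_def cube_sim_def by blast
  then obtain c where c: "\<And>i j. i \<in> ?L \<Longrightarrow> j \<in> J i \<Longrightarrow> cube_sim (S i j) (c i j) \<and> c i j < 1"
    by metis
  obtain U where U: "U \<noteq> {}" "openin (top_of_set unit_cube) U"
    and sep: "\<forall>i\<in>?L. (\<Union>j\<in>J i. S i j ` U) \<subseteq> U \<and> disjoint_family_on (\<lambda>j. S i j ` U) (J i)"
    using assms(2) unfolding UOSC_def by (elim exE conjE)
  obtain z e where ball: "0 < e" "ball z e \<subseteq> U"
    using openin_unit_cube_contains_ball[OF U(2,1)] .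
  define R where "R = (\<lambda>(i, j). c i j) ` Sigma ?L J"
  have R: "finite R" unfolding R_def using J by (intro finite_imageI finite_SigmaI) auto
  obtain j1 where j1: "j1 \<in> J 1" using J[OF N] by blast
  have c_R: "c i j \<in> R" if "i \<in> ?L" "j \<in> J i" for i j
    unfolding R_def using that by (intro image_eqI[of _ _ "(i, j)"]) auto
  then have R_ne: "R \<noteq> {}" using N j1 by blast
  have R_range: "0 < r \<and> r < 1" if "r \<in> R" for r
  proof -
    from that obtain i j where "i \<in> ?L" "j \<in> J i" "r = c i j"
      by (auto simp: R_def simp del: atLeastAtMost_iff)
    then show ?thesis using c[of i j] cube_sim_pos[of "S i j"] by blast
  qed
  interpret separated_RIFS ?L J S c "Min R" "Max R" U z e
  proof
    show "Min R \<le> c i j" "c i j \<le> Max R" if "i \<in> ?L" "j \<in> J i" for i j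
      using c_R[OF that] R by auto
    show "0 < Min R" "Min R < 1" "0 < Max R" "Max R < 1"
      using R_range Min_in[OF R R_ne] Max_in[OF R R_ne] by auto
    show "U \<subseteq> unit_cube" using openin_imp_subset[OF U(2)] .
    show "S i j ` U \<subseteq> U" if "i \<in> ?L" "j \<in> J i" for i j
      using sep that by blast
    show "disjoint_family_on (\<lambda>j. S i j ` U) (J i)" if "i \<in> ?L" for i
      using sep that by blast
  qed (use J c ball in auto)
  have "\<exists>s\<ge>0. (\<Sum>j\<in>J i. c i j powr s) = 1" if i: "i \<in> ?L" for i
  proof -
    have "0 < c i j \<and> c i j < 1" if "j \<in> J i" for j
      using R_range c_R[OF i that] by blast
    then show ?thesis
      using moran_equation_solvable[of "J i" "c i"] J[OF i] by blast
  qed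
  then obtain s where s: "\<And>i. i \<in> ?L \<Longrightarrow> 0 \<le> s i \<and> (\<Sum>j\<in>J i. c i j powr s i) = 1"
    by metis
  \<comment> \<open>A constant sequence is its own witness for the runs.\<close>
  have const: "assouad_dim (F (\<lambda>_. i)) = s i" if i: "i \<in> ?L" for i
    using s[OF i] i by (intro assouad_dim_attractor[where i = i]) auto
  have "Max (s ` ?L) \<in> s ` ?L" using N by (intro Max_in) auto
  then obtain i where i: "i \<in> ?L" "s i = Max (s ` ?L)" by auto
  have s_le: "s i' \<le> s i" if "i' \<in> ?L" for i' using that i by auto
  have "AE \<omega> in bernoulli_measure N p. \<forall>n. \<exists>k. \<forall>l<n. \<omega> (k + l) = i"
    unfolding AE_all_countable using AE_bernoulli_run[OF assms(3) i(1)] by blast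
  moreover have "AE \<omega> in bernoulli_measure N p. \<omega> \<in> UNIV \<rightarrow> ?L"
    using AE_space[of "bernoulli_measure N p"] by (simp add: space_bernoulli_measure)
  ultimately show ?thesis
  proof eventually_elim
    fix \<omega> :: "nat \<Rightarrow> nat" assume runs: "\<forall>n. \<exists>k. \<forall>l<n. \<omega> (k + l) = i" and \<omega>: "\<omega> \<in> UNIV \<rightarrow> ?L"
    have "assouad_dim (F \<omega>) = s i"
    proof (rule assouad_dim_attractor[OF \<omega>])
      fix k
      have \<omega>k: "\<omega> k \<in> ?L" using \<omega> by auto
      have "(\<Sum>j\<in>J (\<omega> k). c (\<omega> k) j powr s i) \<le> (\<Sum>j\<in>J (\<omega> k). c (\<omega> k) j powr s (\<omega> k))"
        using R_range c_R[OF \<omega>k] s_le[OF \<omega>k]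
        by (intro sum_mono powr_mono') (auto intro: less_imp_le)
      then show "(\<Sum>j\<in>J (\<omega> k). c (\<omega> k) j powr s i) \<le> 1" using s[OF \<omega>k] by simp
    qed (use runs s[OF i(1)] in auto)
    also have "\<dots> = Max ((\<lambda>i. assouad_dim (F (\<lambda>_. i))) ` ?L)"
      using i(2) const by (simp add: image_cong[OF refl const])
    finally show "assouad_dim (F \<omega>) = Max ((\<lambda>i. assouad_dim (F (\<lambda>_. i))) ` ?L)" .
  qed
qed

end
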